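(* Let $G$ be a finite group, $H\unlhd G$ and $g\in G$. If $\tilde\zeta(g)$ denotes the number of elements $(h_1,g_2)\in H\times G$ satisfying $[h_1,g_2]=g$, then $\tilde\zeta$ is a class function of $G$ and $$\tilde\zeta(g)=\sum_{\chi\in\operatorname{Irr}(G)}\frac{|H|\,[\chi_H,\chi_H]}{\chi(1)}\,\chi(g)=\sum_{\chi\in\operatorname{Irr}(G)}\frac{|H|\,[\chi_H^G,\chi]}{\chi(1)}\,\chi(g).$$
   Context: $[x,y]=xyx^{-1}y^{-1}$ for group elements $x,y$. $\operatorname{Irr}(G)$ is the set of irreducible complex characters of $G$; $\chi_H$ is the restriction of $\chi$ to $H$; $\chi_H^G$ is the character of $G$ induced from $\chi_H$; $[\cdot,\cdot]$ applied to class functions is the usual inner product on class functions of the relevant group ($H$ for $[\chi_H,\chi_H]$, $G$ for $[\chi_H^G,\chi]$). *)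

theory Defs
  imports "HOL-Algebra.Coset" "Jordan_Normal_Form.VS_Connect"
begin

abbreviation general_linear :: "nat \<Rightarrow> complex mat monoid" where
  "general_linear n \<equiv> units_of (ring_mat TYPE(complex) n ())"

definition representation :: "('a, 'b) monoid_scheme \<Rightarrow> nat \<Rightarrow> ('a \<Rightarrow> complex mat) \<Rightarrow> bool" where
  "representation G n \<rho> \<longleftrightarrow> \<rho> \<in> hom G (general_linear n)"

definition invariant_subspace ::
    "('a, 'b) monoid_scheme \<Rightarrow> nat \<Rightarrow> ('a \<Rightarrow> complex mat) \<Rightarrow> complex vec set \<Rightarrow> bool" where
  "invariant_subspace G n \<rho> W \<longleftrightarrow>
     VectorSpace.subspace class_ring W (module_vec TYPE(complex) n) \<and>
     (\<forall>g\<in>carrier G. \<forall>w\<in>W. \<rho> g *\<^sub>v w \<in> W)"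

text \<open>The zero representation (\<open>n = 0\<close>) is not irreducible.\<close>

definition irreducible_representation ::
    "('a, 'b) monoid_scheme \<Rightarrow> nat \<Rightarrow> ('a \<Rightarrow> complex mat) \<Rightarrow> bool" where
  "irreducible_representation G n \<rho> \<longleftrightarrow>
     representation G n \<rho> \<and> n > 0 \<and>
     (\<forall>W. invariant_subspace G n \<rho> W \<longrightarrow> W = {0\<^sub>v n} \<or> W = carrier_vec n)"

definition mat_trace :: "complex mat \<Rightarrow> complex" where
  "mat_trace A = (\<Sum>i<dim_row A. A $$ (i, i))"

text \<open>Characters are made extensional (\<open>undefined\<close> off the carrier), so that distinct elements of
  \<open>Irr G\<close> are distinct as functions on the group.\<close>

definition afforded_character :: "('a, 'b) monoid_scheme \<Rightarrow> ('a \<Rightarrow> complex mat) \<Rightarrow> 'a \<Rightarrow> complex" where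
  "afforded_character G \<rho> = (\<lambda>g\<in>carrier G. mat_trace (\<rho> g))"

definition Irr :: "('a, 'b) monoid_scheme \<Rightarrow> ('a \<Rightarrow> complex) set" where
  "Irr G = {afforded_character G \<rho> | n \<rho>. irreducible_representation G n \<rho>}"

definition class_function :: "('a, 'b) monoid_scheme \<Rightarrow> ('a \<Rightarrow> complex) \<Rightarrow> bool" where
  "class_function G f \<longleftrightarrow>
     (\<forall>g\<in>carrier G. \<forall>x\<in>carrier G. f (x \<otimes>\<^bsub>G\<^esub> g \<otimes>\<^bsub>G\<^esub> inv\<^bsub>G\<^esub> x) = f g)"

definition cf_inner :: "('a, 'b) monoid_scheme \<Rightarrow> ('a \<Rightarrow> complex) \<Rightarrow> ('a \<Rightarrow> complex) \<Rightarrow> complex" where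
  "cf_inner G \<phi> \<psi> = (\<Sum>g\<in>carrier G. \<phi> g * cnj (\<psi> g)) / of_nat (Coset.order G)"

definition induced_cf ::
    "('a, 'b) monoid_scheme \<Rightarrow> 'a set \<Rightarrow> ('a \<Rightarrow> complex) \<Rightarrow> 'a \<Rightarrow> complex" where
  "induced_cf G H \<phi> = (\<lambda>g\<in>carrier G.
     (\<Sum>x\<in>carrier G. let y = x \<otimes>\<^bsub>G\<^esub> g \<otimes>\<^bsub>G\<^esub> inv\<^bsub>G\<^esub> x in if y \<in> H then \<phi> y else 0) /
     of_nat (card H))"

definition commutator :: "('a, 'b) monoid_scheme \<Rightarrow> 'a \<Rightarrow> 'a \<Rightarrow> 'a" where
  "commutator G x y = x \<otimes>\<^bsub>G\<^esub> y \<otimes>\<^bsub>G\<^esub> inv\<^bsub>G\<^esub> x \<otimes>\<^bsub>G\<^esub> inv\<^bsub>G\<^esub> y"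

definition commutator_count :: "('a, 'b) monoid_scheme \<Rightarrow> 'a set \<Rightarrow> 'a \<Rightarrow> nat" where
  "commutator_count G H g = card {(h, x). h \<in> H \<and> x \<in> carrier G \<and> commutator G h x = g}"

end

theory Submission
  imports Defs "Jordan_Normal_Form.Schur_Decomposition" "Jordan_Normal_Form.Spectral_Radius"
begin

text \<open>The count \<open>\<zeta>(g)\<close> of pairs \<open>(h, x)\<close> in \<open>H \<times> G\<close> with \<open>[h, x] = g\<close> is a class function, because
  conjugation by an element of \<open>G\<close> permutes \<open>H \<times> G\<close> and commutes with the commutator. Hence
  \<open>\<zeta> = (\<Sum>\<chi>. [\<zeta>, \<chi>] \<chi>)\<close> over the irreducible characters (\<open>class_function_expansion\<close>), and the
  coefficients have to be computed. If \<open>\<rho>\<close> affords \<open>\<chi>\<close>, then \<open>\<Sum>x. \<rho>(x h\<^sup>-\<^sup>1 x\<^sup>-\<^sup>1)\<close> commutes with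
  \<open>\<rho>\<close>, so by Schur's lemma it is the scalar \<open>|G| \<chi>(h\<^sup>-\<^sup>1) / \<chi>(1)\<close>; multiplying by \<open>\<rho>(h)\<close> and taking
  traces, \<open>\<Sum>x. \<chi>([h, x]) = |G| |\<chi>(h)|\<^sup>2 / \<chi>(1)\<close> (\<open>sum_Irr_commutator\<close>). Summing over \<open>h\<close> in \<open>H\<close>
  gives \<open>[\<zeta>, \<chi>] = |H| [\<chi>\<^sub>H, \<chi>\<^sub>H] / \<chi>(1)\<close>, and Frobenius reciprocity turns this into the second formula.

  The character theory behind this is developed with matrices throughout. Orthonormality of the
  irreducible characters follows from Schur's lemma by averaging elementary matrices, together
  with \<open>\<chi>(g\<^sup>-\<^sup>1) = cnj (\<chi>(g))\<close>, which comes from an invariant positive definite Hermitian form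
  (\<open>mat_trace_inv\<close>). Bessel's inequality for the indicator function of the identity then
  bounds the number of irreducible characters by the group order.

  Completeness says that a class function \<open>f\<close> orthogonal to every irreducible character is zero. The
  group algebra element with coefficients \<open>cnj (f g)\<close> is central; it acts on each irreducible
  representation by a scalar of trace zero, hence by zero. Let \<open>A\<close> be its action on the regular
  representation. The range of the adjoint \<open>A\<^sup>*\<close> is an invariant subspace that meets the kernel of \<open>A\<close>
  trivially; if it were nonzero, it would contain an irreducible subrepresentation, which \<open>A\<close>
  kills. So \<open>A = 0\<close>, and \<open>f\<close> can be read off from the entries of \<open>A\<close>. Only the existence of
  irreducible subrepresentations is needed here, not complete reducibility.\<close>

section \<open>Matrices: sums, traces, adjoints\<close>

text \<open>The sum of a family of \<open>n \<times> m\<close> matrices, formed entry by entry; the dimensions are arguments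
  because they are not part of the matrix type.\<close>

definition msum :: "nat \<Rightarrow> nat \<Rightarrow> 'g set \<Rightarrow> ('g \<Rightarrow> complex mat) \<Rightarrow> complex mat" where
  "msum n m A F = mat n m (\<lambda>ij. \<Sum>g\<in>A. F g $$ ij)"

lemma msum_carrier [simp]: "msum n m A F \<in> carrier_mat n m"
  by (simp add: msum_def)

lemma dim_msum [simp]: "dim_row (msum n m A F) = n" "dim_col (msum n m A F) = m"
  by (simp_all add: msum_def)

lemma index_msum [simp]:
  "i < n \<Longrightarrow> j < m \<Longrightarrow> msum n m A F $$ (i, j) = (\<Sum>g\<in>A. F g $$ (i, j))"
  by (simp add: msum_def)

lemma mult_mat_entry:
  "A \<in> carrier_mat n m \<Longrightarrow> B \<in> carrier_mat m k \<Longrightarrow> i < n \<Longrightarrow> j < k \<Longrightarrow>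
    (A * B) $$ (i, j) = (\<Sum>l<m. A $$ (i, l) * B $$ (l, j))"
  by (auto simp: scalar_prod_def atLeast0LessThan)

lemma mult_msum:
  assumes M: "M \<in> carrier_mat k n" and F: "\<And>g. g \<in> A \<Longrightarrow> F g \<in> carrier_mat n m"
  shows "M * msum n m A F = msum k m A (\<lambda>g. M * F g)"
proof (rule eq_matI)
  fix i j assume "i < dim_row (msum k m A (\<lambda>g. M * F g))" "j < dim_col (msum k m A (\<lambda>g. M * F g))"
  then have ij: "i < k" "j < m" by auto
  have "(M * msum n m A F) $$ (i, j) = (\<Sum>l<n. \<Sum>g\<in>A. M $$ (i, l) * F g $$ (l, j))"
    using ij by (simp add: mult_mat_entry[OF M msum_carrier] sum_distrib_left)
  also have "\<dots> = (\<Sum>g\<in>A. (M * F g) $$ (i, j))"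
    unfolding sum.swap[of _ A] using ij by (intro sum.cong refl) (simp add: mult_mat_entry[OF M F] del: index_mult_mat)
  finally show "(M * msum n m A F) $$ (i, j) = msum k m A (\<lambda>g. M * F g) $$ (i, j)"
    using ij by (simp del: index_mult_mat)
qed (use M in auto)

lemma msum_mult:
  assumes M: "M \<in> carrier_mat m k" and F: "\<And>g. g \<in> A \<Longrightarrow> F g \<in> carrier_mat n m"
  shows "msum n m A F * M = msum n k A (\<lambda>g. F g * M)"
proof (rule eq_matI)
  fix i j assume "i < dim_row (msum n k A (\<lambda>g. F g * M))" "j < dim_col (msum n k A (\<lambda>g. F g * M))"
  then have ij: "i < n" "j < k" by auto
  have "(msum n m A F * M) $$ (i, j) = (\<Sum>l<m. \<Sum>g\<in>A. F g $$ (i, l) * M $$ (l, j))"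
    using ij by (simp add: mult_mat_entry[OF msum_carrier M] sum_distrib_right)
  also have "\<dots> = (\<Sum>g\<in>A. (F g * M) $$ (i, j))"
    unfolding sum.swap[of _ A] using ij by (intro sum.cong refl) (simp add: mult_mat_entry[OF F M] del: index_mult_mat)
  finally show "(msum n m A F * M) $$ (i, j) = msum n k A (\<lambda>g. F g * M) $$ (i, j)"
    using ij by (simp del: index_mult_mat)
qed (use M in auto)

lemma msum_cong: "(\<And>g. g \<in> A \<Longrightarrow> F g = F' g) \<Longrightarrow> msum n m A F = msum n m A F'"
  by (simp add: msum_def)

lemma msum_reindex:
  assumes "bij_betw p A B"
  shows "msum n m B F = msum n m A (\<lambda>g. F (p g))"
  unfolding msum_def by (subst sum.reindex_bij_betw[OF assms, symmetric]) simp

lemma mat_trace_msum: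
  assumes "\<And>g. g \<in> A \<Longrightarrow> F g \<in> carrier_mat n n"
  shows "mat_trace (msum n n A F) = (\<Sum>g\<in>A. mat_trace (F g))"
proof -
  have "mat_trace (msum n n A F) = (\<Sum>g\<in>A. \<Sum>i<n. F g $$ (i, i))"
    by (simp add: mat_trace_def sum.swap[of _ A])
  also have "\<dots> = (\<Sum>g\<in>A. mat_trace (F g))"
    unfolding mat_trace_def using assms by (intro sum.cong refl) auto
  finally show ?thesis .
qed

lemma mat_trace_comm:
  assumes A: "A \<in> carrier_mat n m" and B: "B \<in> carrier_mat m n"
  shows "mat_trace (A * B) = mat_trace (B * A)"
proof -
  have "mat_trace (A * B) = (\<Sum>i<n. \<Sum>l<m. A $$ (i, l) * B $$ (l, i))"
    using A B by (simp add: mat_trace_def mult_mat_entry[OF A B] del: index_mult_mat(1))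
  also have "\<dots> = (\<Sum>l<m. \<Sum>i<n. B $$ (l, i) * A $$ (i, l))"
    by (subst sum.swap) (simp add: mult.commute)
  also have "\<dots> = mat_trace (B * A)"
    using A B by (simp add: mat_trace_def mult_mat_entry[OF B A] del: index_mult_mat(1))
  finally show ?thesis .
qed

lemma mat_trace_smult:
  assumes "A \<in> carrier_mat n n"
  shows "mat_trace (c \<cdot>\<^sub>m A) = c * mat_trace A"
  using assms by (auto simp: mat_trace_def sum_distrib_left)

lemma mat_trace_one: "mat_trace (1\<^sub>m n) = of_nat n"
  by (simp add: mat_trace_def)

lemma mat_adjoint_carrier: "A \<in> carrier_mat n m \<Longrightarrow> mat_adjoint A \<in> carrier_mat m n"
  by (auto simp: mat_adjoint_def)

lemma index_mat_adjoint:
  fixes A :: "complex mat"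
  shows "A \<in> carrier_mat n m \<Longrightarrow> i < m \<Longrightarrow> j < n \<Longrightarrow> mat_adjoint A $$ (i, j) = cnj (A $$ (j, i))"
  by (auto simp: mat_adjoint_def mat_of_rows_def)

lemma mat_adjoint_mult:
  fixes A B :: "complex mat"
  assumes A: "A \<in> carrier_mat n m" and B: "B \<in> carrier_mat m k"
  shows "mat_adjoint (A * B) = mat_adjoint B * mat_adjoint A"
proof (rule eq_matI)
  note adj = mat_adjoint_carrier[OF A] mat_adjoint_carrier[OF B]
  fix i j assume "i < dim_row (mat_adjoint B * mat_adjoint A)" "j < dim_col (mat_adjoint B * mat_adjoint A)"
  then have ij: "i < k" "j < n" using adj by auto
  show "mat_adjoint (A * B) $$ (i, j) = (mat_adjoint B * mat_adjoint A) $$ (i, j)"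
    using ij by (simp add: index_mat_adjoint[OF mult_carrier_mat[OF A B]] mult_mat_entry[OF A B]
        mult_mat_entry[OF adj(2,1)] index_mat_adjoint[OF A] index_mat_adjoint[OF B] mult.commute
        del: index_mult_mat)
qed (use mat_adjoint_carrier[OF A] mat_adjoint_carrier[OF B] mat_adjoint_carrier[OF mult_carrier_mat[OF A B]] in auto)

lemma mat_trace_adjoint:
  assumes A: "A \<in> carrier_mat n n"
  shows "mat_trace (mat_adjoint A) = cnj (mat_trace A)"
  using A mat_adjoint_carrier[OF A] by (simp add: mat_trace_def index_mat_adjoint[OF A])

lemma mult_mat_vec_entry:
  "A \<in> carrier_mat n m \<Longrightarrow> v \<in> carrier_vec m \<Longrightarrow> i < n \<Longrightarrow>
    (A *\<^sub>v v) $ i = (\<Sum>l<m. A $$ (i, l) * v $ l)"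
  by (auto simp: scalar_prod_def atLeast0LessThan)

lemma cscalar_prod_adjoint:
  fixes A :: "complex mat"
  assumes A: "A \<in> carrier_mat n m" and v: "v \<in> carrier_vec n" and w: "w \<in> carrier_vec m"
  shows "(mat_adjoint A *\<^sub>v v) \<bullet>c w = v \<bullet>c (A *\<^sub>v w)"
proof -
  have "(mat_adjoint A *\<^sub>v v) \<bullet>c w = (\<Sum>i<m. \<Sum>j<n. cnj (A $$ (j, i)) * v $ j * cnj (w $ i))"
    using w by (simp add: scalar_prod_def atLeast0LessThan sum_distrib_right index_mat_adjoint[OF A]
        mult_mat_vec_entry[OF mat_adjoint_carrier[OF A] v] del: index_mult_mat_vec)
  also have "\<dots> = (\<Sum>j<n. \<Sum>i<m. v $ j * cnj (A $$ (j, i) * w $ i))"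
    by (subst sum.swap) (simp add: mult_ac)
  also have "\<dots> = v \<bullet>c (A *\<^sub>v w)"
    using A by (simp add: scalar_prod_def atLeast0LessThan sum_distrib_left
        mult_mat_vec_entry[OF A w] del: index_mult_mat_vec)
  finally show ?thesis .
qed

lemma msum_mult_vec_cscalar_prod:
  assumes F: "\<And>g. g \<in> A \<Longrightarrow> F g \<in> carrier_mat n m"
    and v: "v \<in> carrier_vec m" and w: "w \<in> carrier_vec n"
  shows "(msum n m A F *\<^sub>v v) \<bullet>c w = (\<Sum>g\<in>A. (F g *\<^sub>v v) \<bullet>c w)"
proof -
  have "(msum n m A F *\<^sub>v v) $ i = (\<Sum>g\<in>A. (F g *\<^sub>v v) $ i)" if i: "i < n" for i
  proof -
    have "(msum n m A F *\<^sub>v v) $ i = (\<Sum>l<m. \<Sum>g\<in>A. F g $$ (i, l) * v $ l)"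
      using i by (simp add: mult_mat_vec_entry[OF msum_carrier v] sum_distrib_right del: index_mult_mat_vec)
    also have "\<dots> = (\<Sum>g\<in>A. (F g *\<^sub>v v) $ i)"
      unfolding sum.swap[of _ A] using i
      by (intro sum.cong refl) (simp add: mult_mat_vec_entry[OF F v] del: index_mult_mat_vec)
    finally show ?thesis .
  qed
  then have "(msum n m A F *\<^sub>v v) \<bullet>c w = (\<Sum>i<n. \<Sum>g\<in>A. (F g *\<^sub>v v) $ i * cnj (w $ i))"
    using w by (simp add: scalar_prod_def atLeast0LessThan sum_distrib_right del: index_mult_mat_vec)
  also have "\<dots> = (\<Sum>g\<in>A. (F g *\<^sub>v v) \<bullet>c w)"
    unfolding sum.swap[of _ A] using w by (intro sum.cong refl) (simp add: scalar_prod_def atLeast0LessThan)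
  finally show ?thesis .
qed

lemma smult_one_mult_mat_vec:
  fixes v :: "complex vec"
  assumes v: "v \<in> carrier_vec n"
  shows "(c \<cdot>\<^sub>m 1\<^sub>m n) *\<^sub>v v = c \<cdot>\<^sub>v v"
proof (rule eq_vecI)
  fix i assume "i < dim_vec (c \<cdot>\<^sub>v v)"
  then have i: "i < n" using v by simp
  have "(1\<^sub>m n *\<^sub>v v) $ i = v $ i" using v by simp
  then show "((c \<cdot>\<^sub>m 1\<^sub>m n) *\<^sub>v v) $ i = (c \<cdot>\<^sub>v v) $ i" using i v by simp
qed (use v in simp)

lemma mult_mat_vec_zero:
  fixes A :: "complex mat"
  shows "A \<in> carrier_mat n m \<Longrightarrow> A *\<^sub>v 0\<^sub>v m = 0\<^sub>v n"
  by (intro eq_vecI) auto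

lemma eq_mat_by_vecI:
  fixes A B :: "complex mat"
  assumes A: "A \<in> carrier_mat n m" and B: "B \<in> carrier_mat n m"
    and eq: "\<And>v. v \<in> carrier_vec m \<Longrightarrow> A *\<^sub>v v = B *\<^sub>v v"
  shows "A = B"
proof (rule eq_matI)
  fix i j assume "i < dim_row B" "j < dim_col B"
  then have ij: "i < n" "j < m" using B by auto
  have "(A *\<^sub>v unit_vec m j) $ i = (B *\<^sub>v unit_vec m j) $ i" using eq by simp
  then show "A $$ (i, j) = B $$ (i, j)" using ij A B by simp
qed (use A B in auto)

text \<open>The elementary \<open>n \<times> m\<close> matrix whose only nonzero entry is a \<open>1\<close> in position \<open>(j, l)\<close>.\<close>

definition elem_mat :: "nat \<Rightarrow> nat \<Rightarrow> nat \<Rightarrow> nat \<Rightarrow> complex mat" where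
  "elem_mat n m j l = mat n m (\<lambda>ab. if ab = (j, l) then 1 else 0)"

lemma elem_mat_carrier: "elem_mat n m j l \<in> carrier_mat n m"
  by (simp add: elem_mat_def)

lemma mult_elem_mat_mult_entry:
  assumes P: "P \<in> carrier_mat n n" and S: "S \<in> carrier_mat m m"
    and i: "i < n" and k: "k < m" and j: "j < n" and l: "l < m"
  shows "(P * elem_mat n m j l * S) $$ (i, k) = P $$ (i, j) * S $$ (l, k)"
proof -
  have "(P * elem_mat n m j l) $$ (i, b) = (if b = l then P $$ (i, j) else 0)" if b: "b < m" for b
  proof -
    have "(P * elem_mat n m j l) $$ (i, b) = (\<Sum>a<n. if a = j then (if b = l then P $$ (i, j) else 0) else 0)"
      unfolding mult_mat_entry[OF P elem_mat_carrier i b] using b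
      by (intro sum.cong refl) (auto simp: elem_mat_def)
    then show ?thesis using j by simp
  qed
  then have "(P * elem_mat n m j l * S) $$ (i, k) = (\<Sum>b<m. if b = l then P $$ (i, j) * S $$ (l, k) else 0)"
    unfolding mult_mat_entry[OF mult_carrier_mat[OF P elem_mat_carrier] S i k]
    by (intro sum.cong refl) auto
  then show ?thesis using l by simp
qed

section \<open>Subspaces of column vectors\<close>

abbreviation vec_subspace :: "nat \<Rightarrow> complex vec set \<Rightarrow> bool" where
  "vec_subspace n W \<equiv> VectorSpace.subspace class_ring W (module_vec TYPE(complex) n)"

lemma vec_subspace_iff:
  "vec_subspace n W \<longleftrightarrow> W \<subseteq> carrier_vec n \<and> 0\<^sub>v n \<in> W \<and>
     (\<forall>v\<in>W. \<forall>w\<in>W. v + w \<in> W) \<and> (\<forall>c. \<forall>v\<in>W. c \<cdot>\<^sub>v v \<in> W)"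
proof -
  interpret V: vec_space "TYPE(complex)" n .
  show ?thesis
    unfolding VectorSpace.subspace_def submodule_def
    using V.vectorspace_axioms V.module_axioms
    by (auto simp: module_vec_simps class_ring_simps)
qed

lemma left_inverse_imp_dim_le:
  fixes R L :: "complex mat"
  assumes R: "R \<in> carrier_mat n m" and L: "L \<in> carrier_mat m n" and LR: "L * R = 1\<^sub>m m"
  shows "m \<le> n"
proof (rule ccontr)
  assume "\<not> m \<le> n"
  then have nm: "n < m" by simp
  \<comment> \<open>Padding both factors with zeros to square matrices keeps the product, but the padded \<open>R\<close> has a zero row.\<close>
  define R' where "R' = mat m m (\<lambda>(i, j). if i < n then R $$ (i, j) else 0)"
  define L' where "L' = mat m m (\<lambda>(i, j). if j < n then L $$ (i, j) else 0)"
  have c: "R' \<in> carrier_mat m m" "L' \<in> carrier_mat m m" by (auto simp: R'_def L'_def)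
  have "L' * R' = L * R"
  proof (rule eq_matI)
    fix i j assume "i < dim_row (L * R)" "j < dim_col (L * R)"
    then have ij: "i < m" "j < m" using R L by auto
    have "(L' * R') $$ (i, j) = (\<Sum>l<m. if l < n then L $$ (i, l) * R $$ (l, j) else 0)"
      unfolding mult_mat_entry[OF c(2,1) ij] using ij by (intro sum.cong) (auto simp: R'_def L'_def)
    also have "\<dots> = (\<Sum>l<n. L $$ (i, l) * R $$ (l, j))"
      using nm by (intro sum.mono_neutral_cong_right) auto
    also have "\<dots> = (L * R) $$ (i, j)" using mult_mat_entry[OF L R ij] by simp
    finally show "(L' * R') $$ (i, j) = (L * R) $$ (i, j)" .
  qed (use c R L in auto)
  then have "R' * L' = 1\<^sub>m m" using mat_mult_left_right_inverse[OF c(2,1)] LR by simp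
  then have "(R' * L') $$ (n, n) = 1" using nm by simp
  moreover have "(R' * L') $$ (n, n) = 0"
    unfolding mult_mat_entry[OF c nm nm] using nm by (intro sum.neutral) (auto simp: R'_def)
  ultimately show False by simp
qed

text \<open>If the columns of \<open>R\<close> lie in \<open>W\<close> and do not span it, then one more column can be added while keeping
  a left inverse: the new column is \<open>x = w - R L w\<close>, which \<open>L\<close> annihilates, and the new row of the left
  inverse is a scaled row of \<open>1 - R L\<close>.\<close>

lemma subspace_parametrization_extend:
  fixes R L :: "complex mat"
  assumes W: "vec_subspace n W"
    and R: "R \<in> carrier_mat n m" and L: "L \<in> carrier_mat m n" and LR: "L * R = 1\<^sub>m m"
    and RW: "\<And>v. v \<in> carrier_vec m \<Longrightarrow> R *\<^sub>v v \<in> W"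
    and w: "w \<in> W" "R *\<^sub>v (L *\<^sub>v w) \<noteq> w"
  shows "\<exists>R' L'. R' \<in> carrier_mat n (Suc m) \<and> L' \<in> carrier_mat (Suc m) n \<and> L' * R' = 1\<^sub>m (Suc m) \<and>
    (\<forall>v\<in>carrier_vec (Suc m). R' *\<^sub>v v \<in> W)"
proof -
  have wc: "w \<in> carrier_vec n" using W w by (auto simp: vec_subspace_iff)
  have Lw: "L *\<^sub>v w \<in> carrier_vec m" using L wc by simp
  define x where "x = w + (- 1) \<cdot>\<^sub>v (R *\<^sub>v (L *\<^sub>v w))"
  have xW: "x \<in> W" using W w RW[OF Lw] by (auto simp: vec_subspace_iff x_def)
  then have xc: "x \<in> carrier_vec n" using W by (auto simp: vec_subspace_iff)
  have RLw: "R *\<^sub>v (L *\<^sub>v w) \<in> carrier_vec n" using R Lw by simp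
  have Lx: "L *\<^sub>v x = 0\<^sub>v m"
  proof -
    have "L *\<^sub>v x = L *\<^sub>v w + (-1) \<cdot>\<^sub>v (L *\<^sub>v (R *\<^sub>v (L *\<^sub>v w)))"
      unfolding x_def using RLw wc L by (simp add: mult_add_distrib_mat_vec[of _ m n] mult_mat_vec[of _ m n])
    also have "L *\<^sub>v (R *\<^sub>v (L *\<^sub>v w)) = L *\<^sub>v w"
      using assoc_mult_mat_vec[OF L R Lw] LR Lw by simp
    also have "L *\<^sub>v w + (-1) \<cdot>\<^sub>v (L *\<^sub>v w) = 0\<^sub>v m"
      using Lw by (intro eq_vecI) (simp_all del: index_mult_mat_vec dim_mult_mat_vec)
    finally show ?thesis .
  qed
  have "x \<noteq> 0\<^sub>v n"
  proof
    assume x0: "x = 0\<^sub>v n"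
    have "(R *\<^sub>v (L *\<^sub>v w)) $ i = w $ i" if "i < n" for i
    proof -
      have "x $ i = 0" using x0 that by simp
      then show ?thesis unfolding x_def using wc RLw R that by (simp del: index_mult_mat_vec)
    qed
    then have "R *\<^sub>v (L *\<^sub>v w) = w" using wc R by (intro eq_vecI) auto
    then show False using w by simp
  qed
  then obtain p where p: "p < n" "x $ p \<noteq> 0" using xc by (metis carrier_vecD eq_vecI index_zero_vec)
  \<comment> \<open>Row \<open>p\<close> of \<open>1 - R L\<close>, scaled so that its product with \<open>x\<close> is 1.\<close>
  define u where "u j = ((if j = p then 1 else 0) - (\<Sum>l<m. R $$ (p, l) * L $$ (l, j))) / x $ p" for j
  define R' where "R' = mat n (Suc m) (\<lambda>(i, j). if j < m then R $$ (i, j) else x $ i)"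
  define L' where "L' = mat (Suc m) n (\<lambda>(i, j). if i < m then L $$ (i, j) else u j)"
  have c: "R' \<in> carrier_mat n (Suc m)" "L' \<in> carrier_mat (Suc m) n" by (auto simp: R'_def L'_def)
  have LRe: "(\<Sum>k<n. L $$ (i, k) * R $$ (k, j)) = (if i = j then 1 else 0)" if "i < m" "j < m" for i j
    using mult_mat_entry[OF L R that] LR that by simp
  have Lxe: "(\<Sum>k<n. L $$ (i, k) * x $ k) = 0" if "i < m" for i
    using mult_mat_vec_entry[OF L xc that] Lx that by simp
  have delta: "(\<Sum>k<n. (if k = p then 1 else 0) * f k) = f p" for f :: "nat \<Rightarrow> complex"
  proof -
    have "(\<Sum>k<n. (if k = p then 1 else 0) * f k) = (\<Sum>k<n. if k = p then f k else 0)"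
      by (intro sum.cong) auto
    then show ?thesis using p by simp
  qed
  have uexp: "(\<Sum>k<n. u k * f k) = (f p - (\<Sum>l<m. R $$ (p, l) * (\<Sum>k<n. L $$ (l, k) * f k))) / x $ p" for f
  proof -
    have "(\<Sum>k<n. u k * f k) = (\<Sum>k<n. (if k = p then 1 else 0) * f k - (\<Sum>l<m. R $$ (p, l) * L $$ (l, k) * f k)) / x $ p"
      unfolding u_def sum_divide_distrib by (intro sum.cong refl) (simp add: left_diff_distrib sum_distrib_right)
    also have "\<dots> = (f p - (\<Sum>k<n. \<Sum>l<m. R $$ (p, l) * L $$ (l, k) * f k)) / x $ p"
      unfolding sum_subtractf delta ..
    also have "(\<Sum>k<n. \<Sum>l<m. R $$ (p, l) * L $$ (l, k) * f k) = (\<Sum>l<m. R $$ (p, l) * (\<Sum>k<n. L $$ (l, k) * f k))"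
      by (subst sum.swap) (simp add: sum_distrib_left mult.assoc)
    finally show ?thesis .
  qed
  have uR: "(\<Sum>k<n. u k * R $$ (k, j)) = 0" if "j < m" for j
  proof -
    have "(\<Sum>l<m. R $$ (p, l) * (\<Sum>k<n. L $$ (l, k) * R $$ (k, j))) = (\<Sum>l<m. if l = j then R $$ (p, l) else 0)"
      using that by (intro sum.cong refl) (auto simp: LRe)
    then show ?thesis unfolding uexp using that by simp
  qed
  have ux: "(\<Sum>k<n. u k * x $ k) = 1"
    unfolding uexp using p by (simp add: Lxe)
  have "L' * R' = 1\<^sub>m (Suc m)"
  proof (rule eq_matI)
    fix i j assume "i < dim_row (1\<^sub>m (Suc m) :: complex mat)" "j < dim_col (1\<^sub>m (Suc m) :: complex mat)"
    then have ij: "i < Suc m" "j < Suc m" by auto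
    have "(L' * R') $$ (i, j) = (\<Sum>k<n. (if i < m then L $$ (i, k) else u k) * (if j < m then R $$ (k, j) else x $ k))"
      unfolding mult_mat_entry[OF c(2,1) ij] using ij by (intro sum.cong) (auto simp: R'_def L'_def)
    also have "\<dots> = 1\<^sub>m (Suc m) $$ (i, j)"
      using ij by (cases "i < m"; cases "j < m") (auto simp: LRe Lxe uR ux less_Suc_eq)
    finally show "(L' * R') $$ (i, j) = 1\<^sub>m (Suc m) $$ (i, j)" .
  qed (use c in auto)
  moreover have "R' *\<^sub>v v \<in> W" if v: "v \<in> carrier_vec (Suc m)" for v
  proof -
    define v' where "v' = vec m (\<lambda>i. v $ i)"
    have v': "v' \<in> carrier_vec m" by (simp add: v'_def)
    have "R' *\<^sub>v v = R *\<^sub>v v' + v $ m \<cdot>\<^sub>v x"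
    proof (rule eq_vecI)
      fix i assume "i < dim_vec (R *\<^sub>v v' + v $ m \<cdot>\<^sub>v x)"
      then have i: "i < n" using xc by simp
      show "(R' *\<^sub>v v) $ i = (R *\<^sub>v v' + v $ m \<cdot>\<^sub>v x) $ i"
      proof -
        have "(R *\<^sub>v v') $ i = (\<Sum>l<m. R $$ (i, l) * v $ l)"
          unfolding mult_mat_vec_entry[OF R v' i] by (simp add: v'_def)
        moreover have "(R' *\<^sub>v v) $ i = (\<Sum>l<m. R $$ (i, l) * v $ l) + x $ i * v $ m"
          unfolding mult_mat_vec_entry[OF c(1) v i] using i by (simp add: R'_def)
        ultimately show ?thesis using i xc R by (simp del: index_mult_mat_vec)
      qed
    qed (use c R xc in auto)
    then show ?thesis using RW[OF v'] xW W by (auto simp: vec_subspace_iff)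
  qed
  ultimately show ?thesis using c by blast
qed

text \<open>A substitute for choosing a basis: every subspace is the range of a matrix \<open>R\<close> with a left inverse
  \<open>L\<close>, and \<open>R L\<close> is a projection onto it.\<close>

lemma subspace_parametrization:
  assumes W: "vec_subspace n W"
  obtains m R L where "m \<le> n" "R \<in> carrier_mat n m" "L \<in> carrier_mat m n" "L * R = 1\<^sub>m m"
    "\<And>v. v \<in> carrier_vec m \<Longrightarrow> R *\<^sub>v v \<in> W" "\<And>w. w \<in> W \<Longrightarrow> R *\<^sub>v (L *\<^sub>v w) = w"
proof -
  define P where "P m \<longleftrightarrow> (\<exists>R L. R \<in> carrier_mat n m \<and> L \<in> carrier_mat m n \<and> L * R = 1\<^sub>m m \<and>
    (\<forall>v\<in>carrier_vec m. R *\<^sub>v v \<in> W))" for m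
  have "P 0"
  proof -
    have "R *\<^sub>v v = 0\<^sub>v n" if "v \<in> carrier_vec 0" "R \<in> carrier_mat n 0" for v :: "complex vec" and R
      using that by (intro eq_vecI) (auto simp: scalar_prod_def)
    moreover have "0\<^sub>v n \<in> W" using W by (auto simp: vec_subspace_iff)
    ultimately show ?thesis
      unfolding P_def by (intro exI[of _ "0\<^sub>m n 0"] exI[of _ "0\<^sub>m 0 n"]) auto
  qed
  moreover have bound: "m \<le> n" if "P m" for m
    using that left_inverse_imp_dim_le unfolding P_def by blast
  ultimately obtain m where m: "P m" and max: "\<And>k. P k \<Longrightarrow> k \<le> m"
    using Nat.ex_has_greatest_nat[of P 0 n] by blast
  from m obtain R L where RL: "R \<in> carrier_mat n m" "L \<in> carrier_mat m n" "L * R = 1\<^sub>m m"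
    "\<And>v. v \<in> carrier_vec m \<Longrightarrow> R *\<^sub>v v \<in> W" unfolding P_def by blast
  have "R *\<^sub>v (L *\<^sub>v w) = w" if "w \<in> W" for w
  proof (rule ccontr)
    assume "R *\<^sub>v (L *\<^sub>v w) \<noteq> w"
    then have "P (Suc m)"
      unfolding P_def using subspace_parametrization_extend[OF W RL that] by blast
    then show False using max by fastforce
  qed
  then show ?thesis using that RL bound[OF m] by blast
qed

section \<open>Representations of a finite group\<close>

text \<open>The regular representation and all averages range over the whole carrier, hence the finiteness assumption.\<close>

locale finite_group = group G for G (structure) +
  assumes fin: "finite (carrier G)"
begin

lemma rep_carrier:
  "representation G n \<rho> \<Longrightarrow> g \<in> carrier G \<Longrightarrow> \<rho> g \<in> carrier_mat n n"
  by (auto simp: representation_def hom_def units_of_def Units_def ring_mat_simps)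

lemma rep_mult:
  "representation G n \<rho> \<Longrightarrow> g \<in> carrier G \<Longrightarrow> h \<in> carrier G \<Longrightarrow> \<rho> (g \<otimes> h) = \<rho> g * \<rho> h"
  by (auto simp: representation_def hom_def units_of_def ring_mat_simps)

lemma rep_one:
  assumes "representation G n \<rho>"
  shows "\<rho> \<one> = 1\<^sub>m n"
proof -
  interpret M: ring "ring_mat TYPE(complex) n ()" by (rule ring_mat)
  have "\<rho> \<in> hom G (general_linear n)" using assms by (simp add: representation_def)
  from hom_one[OF this group_axioms M.units_group] show ?thesis
    by (simp add: units_of_def ring_mat_simps)
qed

lemma rep_inv:
  assumes "representation G n \<rho>" "g \<in> carrier G"
  shows "\<rho> g * \<rho> (inv g) = 1\<^sub>m n" "\<rho> (inv g) * \<rho> g = 1\<^sub>m n"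
  using rep_mult[OF assms(1), of g "inv g"] rep_mult[OF assms(1), of "inv g" g] rep_one[OF assms(1)] assms(2)
  by auto

lemma representationI:
  assumes c: "\<And>g. g \<in> carrier G \<Longrightarrow> \<rho> g \<in> carrier_mat n n"
    and m: "\<And>g h. g \<in> carrier G \<Longrightarrow> h \<in> carrier G \<Longrightarrow> \<rho> (g \<otimes> h) = \<rho> g * \<rho> h"
    and o: "\<rho> \<one> = 1\<^sub>m n"
  shows "representation G n \<rho>"
proof -
  have "\<exists>B\<in>carrier_mat n n. B * \<rho> g = 1\<^sub>m n \<and> \<rho> g * B = 1\<^sub>m n" if g: "g \<in> carrier G" for g
    using c[of "inv g"] m[of g "inv g"] m[of "inv g" g] o g by (intro bexI[of _ "\<rho> (inv g)"]) auto
  then show ?thesis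
    unfolding representation_def hom_def using c m
    by (auto simp: units_of_def Units_def ring_mat_simps)
qed

lemma rep_conj_mat_mult:
  assumes r: "representation G n \<rho>" and h: "h \<in> carrier G" and g: "g \<in> carrier G"
    and A: "A \<in> carrier_mat n m"
  shows "\<rho> h * (\<rho> g * A) = \<rho> (h \<otimes> g) * A"
  using assoc_mult_mat[OF rep_carrier[OF r h] rep_carrier[OF r g] A] rep_mult[OF r h g] by simp

text \<open>The restriction of \<open>\<rho>\<close> to an invariant subspace \<open>W\<close> in coordinates: with \<open>R\<close> and \<open>L\<close> as in
  \<open>subspace_parametrization\<close>, it is \<open>\<sigma> g = L (\<rho> g) R\<close>.\<close>

lemma subrepresentation:
  assumes r: "representation G n \<rho>" and W: "invariant_subspace G n \<rho> W"
  obtains m \<sigma> R L where "m \<le> n" "representation G m \<sigma>" "R \<in> carrier_mat n m" "L \<in> carrier_mat m n"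
    "L * R = 1\<^sub>m m" "\<forall>g\<in>carrier G. \<rho> g * R = R * \<sigma> g"
    "\<forall>v\<in>carrier_vec m. R *\<^sub>v v \<in> W" "\<forall>w\<in>W. R *\<^sub>v (L *\<^sub>v w) = w"
proof -
  have Ws: "vec_subspace n W" and Wi: "\<And>g w. g \<in> carrier G \<Longrightarrow> w \<in> W \<Longrightarrow> \<rho> g *\<^sub>v w \<in> W"
    using W by (auto simp: invariant_subspace_def)
  from subspace_parametrization[OF Ws] obtain m R L where mn: "m \<le> n"
    and R: "R \<in> carrier_mat n m" and L: "L \<in> carrier_mat m n" and LR: "L * R = 1\<^sub>m m"
    and RW: "\<And>v. v \<in> carrier_vec m \<Longrightarrow> R *\<^sub>v v \<in> W" and RL: "\<And>w. w \<in> W \<Longrightarrow> R *\<^sub>v (L *\<^sub>v w) = w"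
    by blast
  define \<sigma> where "\<sigma> g = L * (\<rho> g * R)" for g
  have \<rho>R: "\<rho> g * R \<in> carrier_mat n m" if "g \<in> carrier G" for g
    using rep_carrier[OF r that] R by simp
  have \<sigma>c: "\<sigma> g \<in> carrier_mat m m" if "g \<in> carrier G" for g
    using \<rho>R[OF that] L by (simp add: \<sigma>_def)
  have inter: "\<rho> g * R = R * \<sigma> g" if g: "g \<in> carrier G" for g
  proof (rule eq_mat_by_vecI)
    show "\<rho> g * R \<in> carrier_mat n m" by (rule \<rho>R[OF g])
    show "R * \<sigma> g \<in> carrier_mat n m" using R \<sigma>c[OF g] by simp
    fix v :: "complex vec" assume v: "v \<in> carrier_vec m"
    have 1: "(\<rho> g * R) *\<^sub>v v = \<rho> g *\<^sub>v (R *\<^sub>v v)" by (rule assoc_mult_mat_vec[OF rep_carrier[OF r g] R v])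
    have "(R * \<sigma> g) *\<^sub>v v = R *\<^sub>v (\<sigma> g *\<^sub>v v)" by (rule assoc_mult_mat_vec[OF R \<sigma>c[OF g] v])
    also have "\<sigma> g *\<^sub>v v = L *\<^sub>v ((\<rho> g * R) *\<^sub>v v)"
      unfolding \<sigma>_def by (rule assoc_mult_mat_vec[OF L \<rho>R[OF g] v])
    also have "R *\<^sub>v \<dots> = (\<rho> g * R) *\<^sub>v v"
      unfolding 1 by (intro RL Wi RW g v)
    finally show "(\<rho> g * R) *\<^sub>v v = (R * \<sigma> g) *\<^sub>v v" by simp
  qed
  have "representation G m \<sigma>"
  proof (rule representationI)
    fix g h assume g: "g \<in> carrier G" and h: "h \<in> carrier G"
    have "\<sigma> (g \<otimes> h) = L * (\<rho> g * (\<rho> h * R))"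
      unfolding \<sigma>_def using rep_conj_mat_mult[OF r g h R] by simp
    also have "\<rho> g * (\<rho> h * R) = (\<rho> g * R) * \<sigma> h"
      unfolding inter[OF h] using assoc_mult_mat[OF rep_carrier[OF r g] R \<sigma>c[OF h]] by simp
    also have "L * \<dots> = \<sigma> g * \<sigma> h"
      unfolding \<sigma>_def[of g] using assoc_mult_mat[OF L \<rho>R[OF g] \<sigma>c[OF h]] by simp
    finally show "\<sigma> (g \<otimes> h) = \<sigma> g * \<sigma> h" .
  qed (use \<sigma>c LR R rep_one[OF r] in \<open>auto simp: \<sigma>_def\<close>)
  then show ?thesis using that mn R L LR inter RW RL by blast
qed

text \<open>A subrepresentation of least positive dimension inside \<open>W\<close> is irreducible.\<close>

lemma exists_irreducible_subrepresentation:
  assumes r: "representation G n \<rho>" and W: "invariant_subspace G n \<rho> W" and W0: "W \<noteq> {0\<^sub>v n}"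
  obtains k \<sigma> Q L where "irreducible_representation G k \<sigma>" "Q \<in> carrier_mat n k" "L \<in> carrier_mat k n"
    "L * Q = 1\<^sub>m k" "\<forall>g\<in>carrier G. \<rho> g * Q = Q * \<sigma> g"
    "\<forall>v\<in>carrier_vec k. Q *\<^sub>v v \<in> W"
proof -
  have zero_dim: "U = {0\<^sub>v m}" if "vec_subspace m U" "R \<in> carrier_mat m 0" "L \<in> carrier_mat 0 m"
    "\<And>w. w \<in> U \<Longrightarrow> R *\<^sub>v (L *\<^sub>v w) = w" for m R L and U :: "complex vec set"
  proof -
    have "R *\<^sub>v (L *\<^sub>v w) = 0\<^sub>v m" for w using that(2,3) by (intro eq_vecI) (auto simp: scalar_prod_def)
    then show ?thesis using that by (auto simp: vec_subspace_iff)
  qed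
  define P where "P k \<longleftrightarrow> k > 0 \<and> (\<exists>\<sigma> Q L. representation G k \<sigma> \<and> Q \<in> carrier_mat n k \<and> L \<in> carrier_mat k n \<and>
    L * Q = 1\<^sub>m k \<and> (\<forall>g\<in>carrier G. \<rho> g * Q = Q * \<sigma> g) \<and> (\<forall>v\<in>carrier_vec k. Q *\<^sub>v v \<in> W))" for k
  have "\<exists>k. P k"
  proof -
    obtain m \<sigma> R L where
      *: "m \<le> n" "representation G m \<sigma>" "R \<in> carrier_mat n m" "L \<in> carrier_mat m n"
      "L * R = 1\<^sub>m m" "\<forall>g\<in>carrier G. \<rho> g * R = R * \<sigma> g"
      "\<forall>v\<in>carrier_vec m. R *\<^sub>v v \<in> W" "\<forall>w\<in>W. R *\<^sub>v (L *\<^sub>v w) = w"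
      by (rule subrepresentation[OF r W])
    have "m > 0" 
    proof (rule ccontr)
      assume "\<not> m > 0"
      then show False using zero_dim[where U = W and m = n and R = R and L = L] *(3,4,8) W W0 by (auto simp add: invariant_subspace_def)
    qed
    then show ?thesis using *(2-7) unfolding P_def by blast
  qed
  define k where "k = (LEAST k. P k)"
  have Pk: "P k" and least: "\<And>m. P m \<Longrightarrow> k \<le> m"
    using \<open>\<exists>k. P k\<close> unfolding k_def by (auto intro: LeastI_ex Least_le)
  from Pk obtain \<sigma> Q L where k: "k > 0" and \<sigma>: "representation G k \<sigma>" and Q: "Q \<in> carrier_mat n k"
    and L: "L \<in> carrier_mat k n" and LQ: "L * Q = 1\<^sub>m k"
    and inter: "\<And>g. g \<in> carrier G \<Longrightarrow> \<rho> g * Q = Q * \<sigma> g"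
    and QW: "\<And>v. v \<in> carrier_vec k \<Longrightarrow> Q *\<^sub>v v \<in> W"
    unfolding P_def by blast
  have "U = {0\<^sub>v k} \<or> U = carrier_vec k" if U: "invariant_subspace G k \<sigma> U" for U
  proof (rule disjCI)
    assume Uk: "U \<noteq> carrier_vec k"
    obtain m \<tau> R L' where mk: "m \<le> k" and \<tau>: "representation G m \<tau>"
      and R: "R \<in> carrier_mat k m" and L': "L' \<in> carrier_mat m k" and LR: "L' * R = 1\<^sub>m m"
      and int': "\<forall>g\<in>carrier G. \<sigma> g * R = R * \<tau> g"
      and RU: "\<forall>v\<in>carrier_vec m. R *\<^sub>v v \<in> U" and RL: "\<forall>w\<in>U. R *\<^sub>v (L' *\<^sub>v w) = w"
      by (rule subrepresentation[OF \<sigma> U])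
    have Us: "vec_subspace k U" using U by (simp add: invariant_subspace_def)
    have "m \<noteq> k"
    proof
      assume "m = k"
      then have RL': "R * L' = 1\<^sub>m k" using mat_mult_left_right_inverse[of L' k R] L' R LR by simp
      have "v \<in> U" if v: "v \<in> carrier_vec k" for v
      proof -
        have "v = R *\<^sub>v (L' *\<^sub>v v)" using assoc_mult_mat_vec[OF R L' v] RL' v by simp
        then show ?thesis using RU L' v by (metis mult_mat_vec_carrier)
      qed
      then show False using Uk Us by (auto simp: vec_subspace_iff)
    qed
    then have "\<not> P m" using least mk by fastforce
    have QR: "Q * R \<in> carrier_mat n m" "L' * L \<in> carrier_mat m n" using Q R L L' by auto
    have "L' * L * (Q * R) = L' * (L * (Q * R))" by (rule assoc_mult_mat[OF L' L QR(1)])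
    also have "L * (Q * R) = R" using assoc_mult_mat[OF L Q R] LQ R by simp
    finally have 1: "L' * L * (Q * R) = 1\<^sub>m m" using LR by simp
    have 2: "\<rho> g * (Q * R) = (Q * R) * \<tau> g" if g: "g \<in> carrier G" for g
    proof -
      have "\<rho> g * (Q * R) = Q * \<sigma> g * R"
        using assoc_mult_mat[OF rep_carrier[OF r g] Q R] inter[OF g] by simp
      also have "\<dots> = Q * (R * \<tau> g)"
        using assoc_mult_mat[OF Q rep_carrier[OF \<sigma> g] R] int' g by simp
      also have "\<dots> = (Q * R) * \<tau> g" using assoc_mult_mat[OF Q R rep_carrier[OF \<tau> g]] by simp
      finally show ?thesis .
    qed
    have 3: "(Q * R) *\<^sub>v v \<in> W" if v: "v \<in> carrier_vec m" for v
      using assoc_mult_mat_vec[OF Q R v] QW[of "R *\<^sub>v v"] R v by simp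
    have "m = 0"
    proof (rule ccontr)
      assume "m \<noteq> 0"
      then have "P m" unfolding P_def using \<tau> QR 1 2 3 by blast
      then show False using \<open>\<not> P m\<close> by simp
    qed
    then show "U = {0\<^sub>v k}" using zero_dim[OF Us] RL R L' by blast
  qed
  then have "irreducible_representation G k \<sigma>"
    unfolding irreducible_representation_def using \<sigma> k by blast
  then show ?thesis using that Q L LQ inter QW by blast
qed

section \<open>Schur's lemma\<close>

text \<open>The matrices of the \<open>G\<close>-equivariant linear maps from the space of \<open>\<sigma>\<close> to that of \<open>\<rho>\<close>.\<close>

definition intertwines :: "nat \<Rightarrow> nat \<Rightarrow> ('a \<Rightarrow> complex mat) \<Rightarrow> ('a \<Rightarrow> complex mat) \<Rightarrow> complex mat \<Rightarrow> bool" where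
  "intertwines n m \<rho> \<sigma> T \<longleftrightarrow> T \<in> carrier_mat n m \<and> (\<forall>g\<in>carrier G. \<rho> g * T = T * \<sigma> g)"

lemma intertwines_vec:
  assumes r: "representation G n \<rho>" and s: "representation G m \<sigma>" and T: "intertwines n m \<rho> \<sigma> T"
    and g: "g \<in> carrier G" and v: "v \<in> carrier_vec m"
  shows "\<rho> g *\<^sub>v (T *\<^sub>v v) = T *\<^sub>v (\<sigma> g *\<^sub>v v)"
proof -
  have Tc: "T \<in> carrier_mat n m" using T by (simp add: intertwines_def)
  show ?thesis
    using assoc_mult_mat_vec[OF rep_carrier[OF r g] Tc v] assoc_mult_mat_vec[OF Tc rep_carrier[OF s g] v]
      T g by (simp add: intertwines_def)
qed

lemma kernel_invariant:
  assumes r: "representation G n \<rho>" and s: "representation G m \<sigma>" and T: "intertwines n m \<rho> \<sigma> T"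
  shows "invariant_subspace G m \<sigma> {v \<in> carrier_vec m. T *\<^sub>v v = 0\<^sub>v n}"
proof -
  have Tc: "T \<in> carrier_mat n m" using T by (simp add: intertwines_def)
  have "vec_subspace m {v \<in> carrier_vec m. T *\<^sub>v v = 0\<^sub>v n}"
    using Tc by (auto simp: vec_subspace_iff mult_add_distrib_mat_vec[OF Tc] mult_mat_vec[OF Tc])
  moreover have "T *\<^sub>v (\<sigma> g *\<^sub>v v) = 0\<^sub>v n"
    if g: "g \<in> carrier G" and v: "v \<in> carrier_vec m" "T *\<^sub>v v = 0\<^sub>v n" for g v
    using intertwines_vec[OF r s T g v(1)] v(2) mult_mat_vec_zero[OF rep_carrier[OF r g]] by simp
  ultimately show ?thesis
    unfolding invariant_subspace_def using mult_mat_vec_carrier[OF rep_carrier[OF s]] by auto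
qed

lemma range_invariant:
  assumes r: "representation G n \<rho>" and s: "representation G m \<sigma>" and T: "intertwines n m \<rho> \<sigma> T"
  shows "invariant_subspace G n \<rho> ((\<lambda>v. T *\<^sub>v v) ` carrier_vec m)"
proof -
  have Tc: "T \<in> carrier_mat n m" using T by (simp add: intertwines_def)
  have "vec_subspace n ((\<lambda>v. T *\<^sub>v v) ` carrier_vec m)"
    unfolding vec_subspace_iff
  proof (intro conjI ballI allI)
    show "0\<^sub>v n \<in> (\<lambda>v. T *\<^sub>v v) ` carrier_vec m"
      using Tc by (intro image_eqI[of _ _ "0\<^sub>v m"]) auto
  next
    fix v w assume "v \<in> (\<lambda>v. T *\<^sub>v v) ` carrier_vec m" "w \<in> (\<lambda>v. T *\<^sub>v v) ` carrier_vec m"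
    then show "v + w \<in> (\<lambda>v. T *\<^sub>v v) ` carrier_vec m"
      using mult_add_distrib_mat_vec[OF Tc] by (auto simp flip: mult_add_distrib_mat_vec[OF Tc])
  next
    fix c v assume "v \<in> (\<lambda>v. T *\<^sub>v v) ` carrier_vec m"
    then show "c \<cdot>\<^sub>v v \<in> (\<lambda>v. T *\<^sub>v v) ` carrier_vec m"
      by (auto simp flip: mult_mat_vec[OF Tc])
  qed (use Tc in auto)
  moreover have "\<rho> g *\<^sub>v (T *\<^sub>v v) \<in> (\<lambda>v. T *\<^sub>v v) ` carrier_vec m"
    if g: "g \<in> carrier G" and v: "v \<in> carrier_vec m" for g v
    using intertwines_vec[OF r s T g v] rep_carrier[OF s g] v by simp
  ultimately show ?thesis
    unfolding invariant_subspace_def by blast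
qed

lemma schur_scalar:
  assumes r: "irreducible_representation G n \<rho>" and T: "intertwines n n \<rho> \<rho> T"
  obtains c where "T = c \<cdot>\<^sub>m 1\<^sub>m n"
proof -
  have rep: "representation G n \<rho>" and n: "n > 0" using r by (auto simp: irreducible_representation_def)
  have Tc: "T \<in> carrier_mat n n" using T by (simp add: intertwines_def)
  obtain c where "c \<in> spectrum T" using spectrum_non_empty[OF Tc n] by blast
  then obtain v where v: "v \<in> carrier_vec n" "v \<noteq> 0\<^sub>v n" "T *\<^sub>v v = c \<cdot>\<^sub>v v"
    using Tc by (auto simp: spectrum_def eigenvalue_def eigenvector_def)
  \<comment> \<open>The kernel of \<open>T - c\<close> is a nonzero invariant subspace, hence everything.\<close>
  define S where "S = T + (- c) \<cdot>\<^sub>m 1\<^sub>m n"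
  have Sc: "S \<in> carrier_mat n n" using Tc by (simp add: S_def)
  have Sv: "S *\<^sub>v w = T *\<^sub>v w + (- c) \<cdot>\<^sub>v w" if w: "w \<in> carrier_vec n" for w
    unfolding S_def using w Tc by (simp add: add_mult_distrib_mat_vec[of _ n n] smult_one_mult_mat_vec)
  have "intertwines n n \<rho> \<rho> S"
    unfolding intertwines_def
  proof (intro conjI ballI Sc)
    fix g assume g: "g \<in> carrier G"
    note \<rho>c = rep_carrier[OF rep g]
    have "\<rho> g * S = \<rho> g * T + (- c) \<cdot>\<^sub>m \<rho> g"
      unfolding S_def using \<rho>c Tc by (simp add: mult_add_distrib_mat[of _ n n _ n] mult_smult_distrib[of _ n n _ n])
    also have "\<dots> = S * \<rho> g"
      unfolding S_def using \<rho>c Tc T g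
      by (simp add: add_mult_distrib_mat[of _ n n _ _ n] mult_smult_assoc_mat[of _ n n _ n] intertwines_def)
    finally show "\<rho> g * S = S * \<rho> g" .
  qed
  from kernel_invariant[OF rep rep this]
  have "{v \<in> carrier_vec n. S *\<^sub>v v = 0\<^sub>v n} = {0\<^sub>v n} \<or> {v \<in> carrier_vec n. S *\<^sub>v v = 0\<^sub>v n} = carrier_vec n"
    using r unfolding irreducible_representation_def by blast
  moreover have "S *\<^sub>v v = 0\<^sub>v n" unfolding Sv[OF v(1)] v(3) using v by (intro eq_vecI) auto
  ultimately have ker: "S *\<^sub>v w = 0\<^sub>v n" if "w \<in> carrier_vec n" for w using v that by blast
  have "T = c \<cdot>\<^sub>m 1\<^sub>m n"
  proof (rule eq_mat_by_vecI[OF Tc])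
    fix w :: "complex vec" assume w: "w \<in> carrier_vec n"
    have Tw: "T *\<^sub>v w \<in> carrier_vec n" using Tc w by simp
    have "T *\<^sub>v w = c \<cdot>\<^sub>v w"
    proof (rule eq_vecI)
      fix i assume "i < dim_vec (c \<cdot>\<^sub>v w)"
      then have i: "i < n" using w by simp
      have "(T *\<^sub>v w + (- c) \<cdot>\<^sub>v w) $ i = 0" using ker[OF w] Sv[OF w] i by simp
      then show "(T *\<^sub>v w) $ i = (c \<cdot>\<^sub>v w) $ i" using i w Tw by (simp del: index_mult_mat_vec)
    qed (use Tw w Tc in simp)
    then show "T *\<^sub>v w = (c \<cdot>\<^sub>m 1\<^sub>m n) *\<^sub>v w"
      using w by (simp add: smult_one_mult_mat_vec)
  qed simp
  then show ?thesis using that by blast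
qed

text \<open>The other half of Schur's lemma, in the form needed for characters: a nonzero intertwiner of
  irreducible representations is invertible, so the two representations have the same traces.\<close>

lemma schur_trace_eq:
  assumes r: "irreducible_representation G n \<rho>" and s: "irreducible_representation G m \<sigma>"
    and T: "intertwines n m \<rho> \<sigma> T" and T0: "T \<noteq> 0\<^sub>m n m" and g: "g \<in> carrier G"
  shows "mat_trace (\<rho> g) = mat_trace (\<sigma> g)"
proof -
  have rep: "representation G n \<rho>" and srep: "representation G m \<sigma>"
    using r s by (auto simp: irreducible_representation_def)
  have Tc: "T \<in> carrier_mat n m" using T by (simp add: intertwines_def)
  have "\<exists>v\<in>carrier_vec m. T *\<^sub>v v \<noteq> 0\<^sub>v n"
  proof (rule ccontr)
    assume "\<not> ?thesis"
    then have 0: "T *\<^sub>v v = 0\<^sub>v n" if "v \<in> carrier_vec m" for v using that by blast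
    have "0\<^sub>m n m *\<^sub>v v = 0\<^sub>v n" if "v \<in> carrier_vec m" for v :: "complex vec"
      using that by (intro eq_vecI) (auto simp: scalar_prod_def)
    then show False using eq_mat_by_vecI[OF Tc, of "0\<^sub>m n m"] T0 0 by simp
  qed
  then obtain v where v: "v \<in> carrier_vec m" "T *\<^sub>v v \<noteq> 0\<^sub>v n" by blast
  have ker: "{v \<in> carrier_vec m. T *\<^sub>v v = 0\<^sub>v n} = {0\<^sub>v m}"
    using kernel_invariant[OF rep srep T] s v unfolding irreducible_representation_def by blast
  have "(\<lambda>v. T *\<^sub>v v) ` carrier_vec m \<noteq> {0\<^sub>v n}" using v by blast
  then have ran: "(\<lambda>v. T *\<^sub>v v) ` carrier_vec m = carrier_vec n"
    using range_invariant[OF rep srep T] r unfolding irreducible_representation_def by blast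
  have "\<forall>j. \<exists>w. w \<in> carrier_vec m \<and> T *\<^sub>v w = unit_vec n j"
  proof
    fix j
    have "unit_vec n j \<in> (\<lambda>v. T *\<^sub>v v) ` carrier_vec m" unfolding ran by simp
    then show "\<exists>w. w \<in> carrier_vec m \<and> T *\<^sub>v w = unit_vec n j" by auto
  qed
  then obtain w where w: "\<And>j. w j \<in> carrier_vec m" "\<And>j. T *\<^sub>v w j = unit_vec n j" by metis
  \<comment> \<open>The inverse of \<open>T\<close>, whose columns are preimages of the unit vectors.\<close>
  define S where "S = mat m n (\<lambda>(i, j). w j $ i)"
  have Sc: "S \<in> carrier_mat m n" by (simp add: S_def)
  have TS: "T * S = 1\<^sub>m n"
  proof (rule eq_matI)
    fix i j assume "i < dim_row (1\<^sub>m n :: complex mat)" "j < dim_col (1\<^sub>m n :: complex mat)"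
    then have ij: "i < n" "j < n" by auto
    have "(T * S) $$ (i, j) = (T *\<^sub>v w j) $ i"
      unfolding mult_mat_entry[OF Tc Sc ij] mult_mat_vec_entry[OF Tc w(1) ij(1)]
      using ij by (intro sum.cong refl) (simp add: S_def)
    then show "(T * S) $$ (i, j) = 1\<^sub>m n $$ (i, j)" unfolding w using ij by simp
  qed (use Tc Sc in auto)
  have ST: "S * T = 1\<^sub>m m"
  proof (rule eq_mat_by_vecI)
    fix v :: "complex vec" assume v: "v \<in> carrier_vec m"
    have Tv: "T *\<^sub>v v \<in> carrier_vec n" using Tc v by simp
    define x where "x = S *\<^sub>v (T *\<^sub>v v)"
    have x: "x \<in> carrier_vec m" using Sc Tv by (simp add: x_def)
    have Tx: "T *\<^sub>v x = T *\<^sub>v v"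
      unfolding x_def using assoc_mult_mat_vec[OF Tc Sc Tv] TS Tv by simp
    have "T *\<^sub>v (x + (- 1) \<cdot>\<^sub>v v) = 0\<^sub>v n"
      using x v Tx Tv Tc by (intro eq_vecI) (auto simp add: mult_add_distrib_mat_vec[OF Tc] mult_mat_vec[OF Tc] simp del: index_mult_mat_vec)
    then have "x + (- 1) \<cdot>\<^sub>v v \<in> {v \<in> carrier_vec m. T *\<^sub>v v = 0\<^sub>v n}" using x v by simp
    then have 0: "x + (- 1) \<cdot>\<^sub>v v = 0\<^sub>v m" unfolding ker by simp
    have "x = v"
    proof (rule eq_vecI)
      fix i assume "i < dim_vec v"
      then have i: "i < m" using v by simp
      have "(x + (- 1) \<cdot>\<^sub>v v) $ i = 0" using 0 i by simp
      then show "x $ i = v $ i" using i x v by simp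
    qed (use x v in simp)
    then show "(S * T) *\<^sub>v v = 1\<^sub>m m *\<^sub>v v"
      using assoc_mult_mat_vec[OF Sc Tc v] v by (simp add: x_def)
  qed (use Sc Tc in auto)
  note \<rho>c = rep_carrier[OF rep g] and \<sigma>c = rep_carrier[OF srep g]
  have T\<sigma>: "T * \<sigma> g \<in> carrier_mat n m" using Tc \<sigma>c by simp
  have "\<rho> g = \<rho> g * (T * S)" using TS \<rho>c by simp
  also have "\<dots> = T * \<sigma> g * S"
    using assoc_mult_mat[OF \<rho>c Tc Sc] T g by (simp add: intertwines_def)
  finally have "mat_trace (\<rho> g) = mat_trace (S * (T * \<sigma> g))"
    using mat_trace_comm[OF T\<sigma> Sc] by simp
  also have "S * (T * \<sigma> g) = \<sigma> g" using assoc_mult_mat[OF Sc Tc \<sigma>c] ST \<sigma>c by simp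
  finally show ?thesis .
qed

section \<open>Orthogonality of irreducible characters\<close>

lemma bij_betw_mult_left: "h \<in> carrier G \<Longrightarrow> bij_betw (\<lambda>g. h \<otimes> g) (carrier G) (carrier G)"
  by (rule bij_betw_byWitness[where f' = "\<lambda>g. inv h \<otimes> g"]) (auto simp: m_assoc[symmetric])

lemma bij_betw_mult_right: "h \<in> carrier G \<Longrightarrow> bij_betw (\<lambda>g. g \<otimes> h) (carrier G) (carrier G)"
  by (rule bij_betw_byWitness[where f' = "\<lambda>g. g \<otimes> inv h"]) (auto simp: m_assoc)

lemma bij_betw_inv: "bij_betw (\<lambda>g. inv g) (carrier G) (carrier G)"
  by (rule bij_betw_byWitness[where f' = "\<lambda>g. inv g"]) auto

lemma bij_betw_conj: "h \<in> carrier G \<Longrightarrow> bij_betw (\<lambda>g. h \<otimes> g \<otimes> inv h) (carrier G) (carrier G)"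
  using bij_betw_trans[OF bij_betw_mult_left bij_betw_mult_right[of "inv h"]] by (simp add: comp_def)

lemma order_pos: "card (carrier G) > 0"
  using fin by (auto simp: card_gt_0_iff)

lemma average_intertwines:
  assumes r: "representation G n \<rho>" and s: "representation G m \<sigma>" and A: "A \<in> carrier_mat n m"
  shows "intertwines n m \<rho> \<sigma> (msum n m (carrier G) (\<lambda>g. \<rho> g * A * \<sigma> (inv g)))"
  unfolding intertwines_def
proof (intro conjI ballI msum_carrier)
  fix h assume h: "h \<in> carrier G"
  let ?F = "\<lambda>g. \<rho> g * A * \<sigma> (inv g)"
  note \<rho>c = rep_carrier[OF r] and \<sigma>c = rep_carrier[OF s]
  have F: "?F g \<in> carrier_mat n m" if "g \<in> carrier G" for g
    using \<rho>c[OF that] \<sigma>c[of "inv g"] A that by auto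
  have "?F (h \<otimes> g) * \<sigma> h = \<rho> h * ?F g" if g: "g \<in> carrier G" for g
  proof -
    have gA: "\<rho> g * A \<in> carrier_mat n m" using \<rho>c[OF g] A by simp
    have "\<sigma> (inv (h \<otimes> g)) * \<sigma> h = \<sigma> (inv g)"
      using h g by (simp add: rep_mult[OF s, symmetric] inv_mult_group m_assoc)
    moreover have "\<rho> (h \<otimes> g) * A = \<rho> h * (\<rho> g * A)" using rep_conj_mat_mult[OF r h g A] by simp
    moreover have "?F (h \<otimes> g) * \<sigma> h = (\<rho> (h \<otimes> g) * A) * (\<sigma> (inv (h \<otimes> g)) * \<sigma> h)"
      by (rule assoc_mult_mat[OF mult_carrier_mat[OF \<rho>c A] \<sigma>c \<sigma>c]) (use h g in auto)
    ultimately show ?thesis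
      using assoc_mult_mat[OF \<rho>c[OF h] gA \<sigma>c[of "inv g"]] g by simp
  qed
  note eq = this
  have "msum n m (carrier G) ?F * \<sigma> h = msum n m (carrier G) (\<lambda>g. ?F g * \<sigma> h)"
    by (rule msum_mult[OF \<sigma>c[OF h] F])
  also have "\<dots> = msum n m (carrier G) (\<lambda>g. ?F (h \<otimes> g) * \<sigma> h)"
    by (rule msum_reindex[OF bij_betw_mult_left[OF h]])
  also have "\<dots> = msum n m (carrier G) (\<lambda>g. \<rho> h * ?F g)"
    by (rule msum_cong) (rule eq)
  also have "\<dots> = \<rho> h * msum n m (carrier G) ?F"
    by (rule mult_msum[OF \<rho>c[OF h] F, symmetric])
  finally show "\<rho> h * msum n m (carrier G) ?F = msum n m (carrier G) ?F * \<sigma> h" by simp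
qed

lemma schur_average_scalar:
  assumes ir: "irreducible_representation G n \<rho>" and A: "A \<in> carrier_mat n n"
  shows "msum n n (carrier G) (\<lambda>g. \<rho> g * A * \<rho> (inv g)) =
    (of_nat (card (carrier G)) * mat_trace A / of_nat n) \<cdot>\<^sub>m 1\<^sub>m n"
proof -
  have r: "representation G n \<rho>" and n: "n > 0" using ir by (auto simp: irreducible_representation_def)
  let ?T = "msum n n (carrier G) (\<lambda>g. \<rho> g * A * \<rho> (inv g))"
  obtain c where c: "?T = c \<cdot>\<^sub>m 1\<^sub>m n" using schur_scalar[OF ir average_intertwines[OF r r A]] by blast
  have "mat_trace (\<rho> g * A * \<rho> (inv g)) = mat_trace A" if g: "g \<in> carrier G" for g
  proof -
    note \<rho>g = rep_carrier[OF r g] and \<rho>i = rep_carrier[OF r inv_closed[OF g]]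
    have gA: "\<rho> g * A \<in> carrier_mat n n" using \<rho>g A by simp
    have "mat_trace (\<rho> g * A * \<rho> (inv g)) = mat_trace (\<rho> (inv g) * (\<rho> g * A))"
      by (rule mat_trace_comm[OF gA \<rho>i])
    also have "\<rho> (inv g) * (\<rho> g * A) = A"
      using assoc_mult_mat[OF \<rho>i \<rho>g A] rep_inv[OF r g] A by simp
    finally show ?thesis .
  qed
  moreover have "\<rho> g * A * \<rho> (inv g) \<in> carrier_mat n n" if g: "g \<in> carrier G" for g
    using rep_carrier[OF r g] rep_carrier[OF r inv_closed[OF g]] A by simp
  ultimately have "mat_trace ?T = of_nat (card (carrier G)) * mat_trace A"
    by (simp add: mat_trace_msum)
  moreover have "mat_trace ?T = c * of_nat n"
    unfolding c by (simp add: mat_trace_smult[OF one_carrier_mat] mat_trace_one)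
  ultimately have "c = of_nat (card (carrier G)) * mat_trace A / of_nat n"
    using n by (simp add: field_simps)
  then show ?thesis using c by simp
qed

text \<open>The trace of \<open>\<rho> g\<close> times that of \<open>\<sigma> g\<^sup>-\<^sup>1\<close> is a sum of entries of \<open>\<rho> g E \<sigma> g\<^sup>-\<^sup>1\<close> with \<open>E\<close>
  elementary; summing over \<open>g\<close> produces averages to which Schur's lemma applies.\<close>

lemma mat_trace_mult_mat_trace:
  assumes r: "representation G n \<rho>" and s: "representation G m \<sigma>"
  shows "(\<Sum>g\<in>carrier G. mat_trace (\<rho> g) * mat_trace (\<sigma> (inv g))) =
    (\<Sum>i<n. \<Sum>k<m. msum n m (carrier G) (\<lambda>g. \<rho> g * elem_mat n m i k * \<sigma> (inv g)) $$ (i, k))"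
proof -
  have "mat_trace (\<rho> g) * mat_trace (\<sigma> (inv g)) =
      (\<Sum>i<n. \<Sum>k<m. (\<rho> g * elem_mat n m i k * \<sigma> (inv g)) $$ (i, k))" if g: "g \<in> carrier G" for g
  proof -
    note \<rho>g = rep_carrier[OF r g] and \<sigma>i = rep_carrier[OF s inv_closed[OF g]]
    have "mat_trace (\<rho> g) * mat_trace (\<sigma> (inv g)) = (\<Sum>i<n. \<Sum>k<m. \<rho> g $$ (i, i) * \<sigma> (inv g) $$ (k, k))"
      using \<rho>g \<sigma>i by (simp add: mat_trace_def sum_product)
    then show ?thesis
      by (simp add: mult_elem_mat_mult_entry[OF \<rho>g \<sigma>i] del: index_mult_mat)
  qed
  then have "(\<Sum>g\<in>carrier G. mat_trace (\<rho> g) * mat_trace (\<sigma> (inv g))) =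
      (\<Sum>g\<in>carrier G. \<Sum>i<n. \<Sum>k<m. (\<rho> g * elem_mat n m i k * \<sigma> (inv g)) $$ (i, k))" by simp
  also have "\<dots> = (\<Sum>i<n. \<Sum>g\<in>carrier G. \<Sum>k<m. (\<rho> g * elem_mat n m i k * \<sigma> (inv g)) $$ (i, k))"
    by (rule sum.swap)
  also have "\<dots> = (\<Sum>i<n. \<Sum>k<m. \<Sum>g\<in>carrier G. (\<rho> g * elem_mat n m i k * \<sigma> (inv g)) $$ (i, k))"
    by (intro sum.cong refl sum.swap)
  finally show ?thesis by (simp del: index_mult_mat)
qed

lemma mat_trace_orthogonal:
  assumes r: "irreducible_representation G n \<rho>" and s: "irreducible_representation G m \<sigma>"
    and ne: "g \<in> carrier G" "mat_trace (\<rho> g) \<noteq> mat_trace (\<sigma> g)"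
  shows "(\<Sum>g\<in>carrier G. mat_trace (\<rho> g) * mat_trace (\<sigma> (inv g))) = 0"
proof -
  have rep: "representation G n \<rho>" "representation G m \<sigma>"
    using r s by (auto simp: irreducible_representation_def)
  have "msum n m (carrier G) (\<lambda>g. \<rho> g * elem_mat n m i k * \<sigma> (inv g)) = 0\<^sub>m n m" for i k
    using schur_trace_eq[OF r s average_intertwines[OF rep elem_mat_carrier] _ ne(1)] ne(2) by blast
  then show ?thesis unfolding mat_trace_mult_mat_trace[OF rep] by simp
qed

lemma mat_trace_orthonormal:
  assumes r: "irreducible_representation G n \<rho>"
  shows "(\<Sum>g\<in>carrier G. mat_trace (\<rho> g) * mat_trace (\<rho> (inv g))) = of_nat (card (carrier G))"
proof -
  have rep: "representation G n \<rho>" and n: "n > 0"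
    using r by (auto simp: irreducible_representation_def)
  have tr: "mat_trace (elem_mat n n i k) = (if i = k then 1 else 0)" if "i < n" "k < n" for i k
  proof -
    have "mat_trace (elem_mat n n i k) = (\<Sum>a<n. if a = i then (if i = k then 1 else 0) else 0)"
      by (auto simp: mat_trace_def elem_mat_def intro!: sum.cong)
    then show ?thesis using that by simp
  qed
  have "(\<Sum>g\<in>carrier G. mat_trace (\<rho> g) * mat_trace (\<rho> (inv g))) =
    (\<Sum>i<n. \<Sum>k<n. if k = i then of_nat (card (carrier G)) / of_nat n else 0)"
    unfolding mat_trace_mult_mat_trace[OF rep rep] schur_average_scalar[OF r elem_mat_carrier]
    by (intro sum.cong refl) (auto simp: tr)
  then show ?thesis using n by simp
qed

text \<open>The matrix \<open>B = (\<Sum>h. (\<rho> h)\<^sup>* (\<rho> h))\<close> is positive definite and satisfies \<open>(\<rho> g)\<^sup>* B (\<rho> g) = B\<close>, so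
  \<open>\<rho> g\<^sup>-\<^sup>1\<close> is similar to the adjoint of \<open>\<rho> g\<close>.\<close>

lemma mat_trace_inv:
  assumes r: "representation G n \<rho>" and g: "g \<in> carrier G"
  shows "mat_trace (\<rho> (inv g)) = cnj (mat_trace (\<rho> g))"
proof -
  note \<rho>c = rep_carrier[OF r] note ac = mat_adjoint_carrier[OF \<rho>c]
  let ?F = "\<lambda>h. mat_adjoint (\<rho> h) * \<rho> h"
  have F: "?F h \<in> carrier_mat n n" if "h \<in> carrier G" for h using \<rho>c[OF that] ac[OF that] by simp
  define B where "B = msum n n (carrier G) ?F"
  have Bc: "B \<in> carrier_mat n n" by (simp add: B_def)
  have "mat_adjoint (\<rho> g) * (?F h * \<rho> g) = ?F (h \<otimes> g)" if h: "h \<in> carrier G" for h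
  proof -
    have "?F (h \<otimes> g) = (mat_adjoint (\<rho> g) * mat_adjoint (\<rho> h)) * (\<rho> h * \<rho> g)"
      using rep_mult[OF r h g] mat_adjoint_mult[OF \<rho>c[OF h] \<rho>c[OF g]] by simp
    also have "\<dots> = mat_adjoint (\<rho> g) * (mat_adjoint (\<rho> h) * (\<rho> h * \<rho> g))"
      by (rule assoc_mult_mat[OF ac[OF g] ac[OF h] mult_carrier_mat[OF \<rho>c[OF h] \<rho>c[OF g]]])
    also have "mat_adjoint (\<rho> h) * (\<rho> h * \<rho> g) = ?F h * \<rho> g"
      using assoc_mult_mat[OF ac[OF h] \<rho>c[OF h] \<rho>c[OF g]] by simp
    finally show ?thesis by simp
  qed
  note eq = this
  have Fg: "?F h * \<rho> g \<in> carrier_mat n n" if "h \<in> carrier G" for h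
    using F[OF that] \<rho>c[OF g] by simp
  have inv: "mat_adjoint (\<rho> g) * (B * \<rho> g) = B"
  proof -
    have "B * \<rho> g = msum n n (carrier G) (\<lambda>h. ?F h * \<rho> g)"
      unfolding B_def by (rule msum_mult[OF \<rho>c[OF g] F])
    then have "mat_adjoint (\<rho> g) * (B * \<rho> g) = mat_adjoint (\<rho> g) * msum n n (carrier G) (\<lambda>h. ?F h * \<rho> g)"
      by simp
    also have "\<dots> = msum n n (carrier G) (\<lambda>h. mat_adjoint (\<rho> g) * (?F h * \<rho> g))"
      by (rule mult_msum[OF ac[OF g] Fg])
    also have "\<dots> = msum n n (carrier G) (\<lambda>h. ?F (h \<otimes> g))"
      by (rule msum_cong) (rule eq)
    also have "\<dots> = B"
      unfolding B_def by (rule msum_reindex[OF bij_betw_mult_right[OF g], symmetric])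
    finally show ?thesis .
  qed
  have "det B \<noteq> 0"
  proof
    assume "det B = 0"
    then obtain v where v: "v \<in> carrier_vec n" "v \<noteq> 0\<^sub>v n" "B *\<^sub>v v = 0\<^sub>v n"
      using det_0_iff_vec_prod_zero[OF Bc] by blast
    have "(?F h *\<^sub>v v) \<bullet>c v = (\<rho> h *\<^sub>v v) \<bullet>c (\<rho> h *\<^sub>v v)" if h: "h \<in> carrier G" for h
      using cscalar_prod_adjoint[OF \<rho>c[OF h], of "\<rho> h *\<^sub>v v" v] v(1) \<rho>c[OF h]
        assoc_mult_mat_vec[OF ac[OF h] \<rho>c[OF h] v(1)] by simp
    then have "(\<Sum>h\<in>carrier G. (\<rho> h *\<^sub>v v) \<bullet>c (\<rho> h *\<^sub>v v)) = (\<Sum>h\<in>carrier G. (?F h *\<^sub>v v) \<bullet>c v)"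
      by (intro sum.cong refl) simp
    also have "\<dots> = (B *\<^sub>v v) \<bullet>c v"
      unfolding B_def by (rule msum_mult_vec_cscalar_prod[OF F v(1) v(1), symmetric])
    also have "\<dots> = 0" using v by simp
    finally have "\<forall>h\<in>carrier G. (\<rho> h *\<^sub>v v) \<bullet>c (\<rho> h *\<^sub>v v) = 0"
      by (subst (asm) sum_nonneg_eq_0_iff) (auto simp: fin)
    then have "(\<rho> \<one> *\<^sub>v v) \<bullet>c (\<rho> \<one> *\<^sub>v v) = 0" by blast
    then show False using rep_one[OF r] v by simp
  qed
  then obtain C where C: "C \<in> carrier_mat n n" "C * B = 1\<^sub>m n" "B * C = 1\<^sub>m n"
    using det_non_zero_imp_unit[OF Bc, of "()"] by (auto simp: Units_def ring_mat_simps)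
  note \<rho>i = \<rho>c[OF inv_closed[OF g]]
  have Bg: "B * \<rho> g \<in> carrier_mat n n" and aB: "mat_adjoint (\<rho> g) * B \<in> carrier_mat n n"
    using Bc \<rho>c[OF g] ac[OF g] by auto
  have "B * \<rho> (inv g) = mat_adjoint (\<rho> g) * (B * \<rho> g) * \<rho> (inv g)" using inv by simp
  also have "\<dots> = mat_adjoint (\<rho> g) * (B * \<rho> g * \<rho> (inv g))" by (rule assoc_mult_mat[OF ac[OF g] Bg \<rho>i])
  also have "B * \<rho> g * \<rho> (inv g) = B"
    using assoc_mult_mat[OF Bc \<rho>c[OF g] \<rho>i] rep_inv[OF r g] Bc by simp
  finally have *: "B * \<rho> (inv g) = mat_adjoint (\<rho> g) * B" .
  have "\<rho> (inv g) = C * (mat_adjoint (\<rho> g) * B)"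
    using assoc_mult_mat[OF C(1) Bc \<rho>i] C(2) \<rho>i * by simp
  then have "mat_trace (\<rho> (inv g)) = mat_trace (mat_adjoint (\<rho> g) * B * C)"
    using mat_trace_comm[OF C(1) aB] by simp
  also have "mat_adjoint (\<rho> g) * B * C = mat_adjoint (\<rho> g)"
    using assoc_mult_mat[OF ac[OF g] Bc C(1)] C(3) ac[OF g] by simp
  finally show ?thesis using mat_trace_adjoint[OF \<rho>c[OF g]] by simp
qed

lemma Irr_cases:
  assumes "\<chi> \<in> Irr G"
  obtains n \<rho> where "irreducible_representation G n \<rho>" "representation G n \<rho>" "n > 0"
    "\<chi> = afforded_character G \<rho>" "\<chi> \<one> = of_nat n"
    "\<And>g. g \<in> carrier G \<Longrightarrow> \<chi> g = mat_trace (\<rho> g)"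
proof -
  obtain n \<rho> where r: "irreducible_representation G n \<rho>" and \<chi>: "\<chi> = afforded_character G \<rho>"
    using assms unfolding Irr_def by blast
  have \<rho>: "representation G n \<rho>" and n: "n > 0" using r by (auto simp: irreducible_representation_def)
  have c: "\<chi> g = mat_trace (\<rho> g)" if "g \<in> carrier G" for g using that by (simp add: \<chi> afforded_character_def)
  have "\<chi> \<one> = of_nat n" using c rep_one[OF \<rho>] by (simp add: mat_trace_one)
  from that[OF r \<rho> n \<chi> this c] show ?thesis by simp
qed

lemma Irr_class_function:
  assumes "\<chi> \<in> Irr G"
  shows "class_function G \<chi>"
  unfolding class_function_def
proof (intro ballI)
  fix g x assume g: "g \<in> carrier G" and x: "x \<in> carrier G"
  from assms obtain n \<rho> where r: "representation G n \<rho>"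
    and c: "\<And>g. g \<in> carrier G \<Longrightarrow> \<chi> g = mat_trace (\<rho> g)" by (rule Irr_cases) blast
  have "\<chi> (x \<otimes> g \<otimes> inv x) = mat_trace (\<rho> (x \<otimes> g) * \<rho> (inv x))"
    using c x g by (simp add: rep_mult[OF r])
  also have "\<dots> = mat_trace (\<rho> (inv x) * \<rho> (x \<otimes> g))"
    by (rule mat_trace_comm[OF rep_carrier[OF r] rep_carrier[OF r]]) (use x g in auto)
  also have "\<rho> (inv x) * \<rho> (x \<otimes> g) = \<rho> g"
    using x g by (simp add: rep_mult[OF r, symmetric] m_assoc[symmetric])
  finally show "\<chi> (x \<otimes> g \<otimes> inv x) = \<chi> g" using c[OF g] by simp
qed

lemma Irr_orthonormal:
  assumes \<chi>: "\<chi> \<in> Irr G" and \<psi>: "\<psi> \<in> Irr G"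
  shows "cf_inner G \<chi> \<psi> = (if \<chi> = \<psi> then 1 else 0)"
proof -
  from \<chi> obtain n \<rho> where r: "irreducible_representation G n \<rho>" "\<chi> = afforded_character G \<rho>"
    "\<And>g. g \<in> carrier G \<Longrightarrow> \<chi> g = mat_trace (\<rho> g)" by (rule Irr_cases) blast
  from \<psi> obtain m \<sigma> where s: "irreducible_representation G m \<sigma>" "representation G m \<sigma>" "\<psi> = afforded_character G \<sigma>"
    "\<And>g. g \<in> carrier G \<Longrightarrow> \<psi> g = mat_trace (\<sigma> g)" by (rule Irr_cases) blast
  have eq: "cf_inner G \<chi> \<psi> = (\<Sum>g\<in>carrier G. mat_trace (\<rho> g) * mat_trace (\<sigma> (inv g))) / of_nat (card (carrier G))"
    unfolding cf_inner_def by (simp add: r(3) s(4) mat_trace_inv[OF s(2)] Coset.order_def)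
  show ?thesis
  proof (cases "\<chi> = \<psi>")
    case True
    have tr: "mat_trace (\<rho> g) = mat_trace (\<sigma> g)" if "g \<in> carrier G" for g
      using True r(3)[OF that] s(4)[OF that] by simp
    have "cf_inner G \<chi> \<psi> = (\<Sum>g\<in>carrier G. mat_trace (\<sigma> g) * mat_trace (\<sigma> (inv g))) / of_nat (card (carrier G))"
      unfolding eq by (simp add: tr)
    then show ?thesis using True mat_trace_orthonormal[OF s(1)] order_pos by simp
  next
    case False
    then obtain g where "g \<in> carrier G" "mat_trace (\<rho> g) \<noteq> mat_trace (\<sigma> g)"
      using r(2) s(3) by (auto simp: afforded_character_def restrict_def fun_eq_iff split: if_splits)
    then show ?thesis using False mat_trace_orthogonal[OF r(1) s(1)] eq by simp
  qed
qed

section \<open>There are finitely many irreducible characters\<close>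

lemma cf_inner_diff_left: "cf_inner G (\<lambda>g. f g - f' g) h = cf_inner G f h - cf_inner G f' h"
  by (simp add: cf_inner_def left_diff_distrib sum_subtractf diff_divide_distrib)

lemma cnj_cf_inner: "cnj (cf_inner G f h) = cf_inner G h f"
  by (simp add: cf_inner_def mult.commute)

lemma cf_inner_sum_left: "cf_inner G (\<lambda>g. \<Sum>i\<in>I. c i * f i g) h = (\<Sum>i\<in>I. c i * cf_inner G (f i) h)"
proof -
  have "(\<Sum>g\<in>carrier G. (\<Sum>i\<in>I. c i * f i g) * cnj (h g)) = (\<Sum>i\<in>I. c i * (\<Sum>g\<in>carrier G. f i g * cnj (h g)))"
    unfolding sum_distrib_right sum_distrib_left by (subst sum.swap) (simp add: mult.assoc)
  then have "cf_inner G (\<lambda>g. \<Sum>i\<in>I. c i * f i g) h =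
      (\<Sum>i\<in>I. c i * (\<Sum>g\<in>carrier G. f i g * cnj (h g))) / of_nat (Coset.order G)"
    by (simp add: cf_inner_def)
  then show ?thesis by (subst (asm) sum_divide_distrib) (simp add: cf_inner_def)
qed

lemma cf_inner_projection:
  assumes F: "finite F" "F \<subseteq> Irr G" and \<psi>: "\<psi> \<in> F"
  shows "cf_inner G (\<lambda>g. f g - (\<Sum>\<chi>\<in>F. cf_inner G f \<chi> * \<chi> g)) \<psi> = 0"
proof -
  have "(\<Sum>\<chi>\<in>F. cf_inner G f \<chi> * cf_inner G \<chi> \<psi>) = (\<Sum>\<chi>\<in>F. if \<chi> = \<psi> then cf_inner G f \<psi> else 0)"
    using F \<psi> by (intro sum.cong refl) (auto simp: Irr_orthonormal subset_iff)
  then show ?thesis using F \<psi> by (simp add: cf_inner_diff_left cf_inner_sum_left)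
qed

lemma bessel_inequality:
  assumes F: "finite F" "F \<subseteq> Irr G"
  shows "(\<Sum>\<chi>\<in>F. (cmod (cf_inner G f \<chi>))\<^sup>2) \<le> Re (cf_inner G f f)"
proof -
  define p where "p g = (\<Sum>\<chi>\<in>F. cf_inner G f \<chi> * \<chi> g)" for g
  define d where "d g = f g - p g" for g
  have d\<psi>: "cf_inner G d \<psi> = 0" if "\<psi> \<in> F" for \<psi>
    using cf_inner_projection[OF F that] by (simp add: d_def[abs_def] p_def)
  have "cf_inner G p d = (\<Sum>\<chi>\<in>F. cf_inner G f \<chi> * cf_inner G \<chi> d)"
    unfolding p_def by (rule cf_inner_sum_left)
  also have "\<dots> = 0" using d\<psi> cnj_cf_inner[of d] by (intro sum.neutral) (metis complex_cnj_zero mult_zero_right)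
  finally have pd: "cf_inner G p d = 0" .
  have "cf_inner G d d = cf_inner G f d - cf_inner G p d"
    by (subst (1) d_def[abs_def]) (rule cf_inner_diff_left)
  also have "\<dots> = cnj (cf_inner G d f)" by (simp add: pd cnj_cf_inner)
  also have "cf_inner G d f = cf_inner G f f - (\<Sum>\<chi>\<in>F. cf_inner G f \<chi> * cf_inner G \<chi> f)"
    unfolding d_def cf_inner_diff_left unfolding p_def cf_inner_sum_left ..
  also have "(\<Sum>\<chi>\<in>F. cf_inner G f \<chi> * cf_inner G \<chi> f) = of_real (\<Sum>\<chi>\<in>F. (cmod (cf_inner G f \<chi>))\<^sup>2)"
    unfolding of_real_sum by (intro sum.cong refl) (metis cnj_cf_inner complex_norm_square)
  finally have "Re (cf_inner G d d) = Re (cf_inner G f f) - (\<Sum>\<chi>\<in>F. (cmod (cf_inner G f \<chi>))\<^sup>2)" by simp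
  moreover have "cf_inner G d d = of_real ((\<Sum>g\<in>carrier G. (cmod (d g))\<^sup>2) / card (carrier G))"
    by (simp add: cf_inner_def Coset.order_def complex_norm_square del: of_real_power)
  then have "Re (cf_inner G d d) = (\<Sum>g\<in>carrier G. (cmod (d g))\<^sup>2) / card (carrier G)"
    by (simp only: Re_complex_of_real)
  then have "Re (cf_inner G d d) \<ge> 0" by (simp add: sum_nonneg)
  ultimately show ?thesis by simp
qed

lemma finite_Irr: "finite (Irr G)"
proof (rule ccontr)
  assume "infinite (Irr G)"
  define N where "N = card (carrier G)"
  have N: "N > 0" using order_pos by (simp add: N_def)
  obtain F where F: "finite F" "F \<subseteq> Irr G" "card F = Suc N"
    using infinite_arbitrarily_large[OF \<open>infinite (Irr G)\<close>] by metis
  define f :: "'a \<Rightarrow> complex" where "f g = (if g = \<one> then 1 else 0)" for g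
  have f: "cf_inner G f h = cnj (h \<one>) / of_nat N" for h
  proof -
    have "(\<Sum>g\<in>carrier G. f g * cnj (h g)) = (\<Sum>g\<in>carrier G. if g = \<one> then cnj (h \<one>) else 0)"
      by (intro sum.cong) (auto simp: f_def)
    then show ?thesis using fin by (simp add: cf_inner_def Coset.order_def N_def)
  qed
  \<comment> \<open>The coefficient of the indicator function at \<open>\<chi>\<close> is \<open>\<chi>(1) / N\<close>, and \<open>\<chi>(1) \<ge> 1\<close>.\<close>
  have "(1 / real N)\<^sup>2 \<le> (cmod (cf_inner G f \<chi>))\<^sup>2" if "\<chi> \<in> F" for \<chi>
  proof -
    have "\<chi> \<in> Irr G" using that F by blast
    then obtain n where "n > 0" "\<chi> \<one> = of_nat n" by (rule Irr_cases) blast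
    then have "cmod (cf_inner G f \<chi>) = real n / real N" by (simp add: f norm_divide)
    moreover have "1 / real N \<le> real n / real N" using \<open>n > 0\<close> N by (intro divide_right_mono) auto
    ultimately show ?thesis by (intro power_mono) auto
  qed
  then have "real (card F) * (1 / real N)\<^sup>2 \<le> (\<Sum>\<chi>\<in>F. (cmod (cf_inner G f \<chi>))\<^sup>2)"
    by (rule sum_bounded_below)
  also have "\<dots> \<le> 1 / real N" using bessel_inequality[OF F(1,2), of f] by (simp add: f f_def)
  finally have "real (Suc N) \<le> real N" using N F(3) by (simp add: field_simps power2_eq_square)
  then show False by simp
qed

section \<open>Completeness of the irreducible characters\<close>

text \<open>The action, under the \<open>n\<close>-dimensional representation \<open>\<rho>\<close>, of the group algebra element with
  coefficient function \<open>a\<close>. It is an intertwiner when \<open>a\<close> is a class function.\<close>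

definition group_sum :: "nat \<Rightarrow> ('a \<Rightarrow> complex) \<Rightarrow> ('a \<Rightarrow> complex mat) \<Rightarrow> complex mat" where
  "group_sum n a \<rho> = msum n n (carrier G) (\<lambda>g. a g \<cdot>\<^sub>m \<rho> g)"

lemma group_sum_carrier: "group_sum n a \<rho> \<in> carrier_mat n n"
  by (simp add: group_sum_def)

lemma group_sum_intertwines:
  assumes r: "representation G n \<rho>" and a: "class_function G a"
  shows "intertwines n n \<rho> \<rho> (group_sum n a \<rho>)"
  unfolding intertwines_def
proof (intro conjI ballI group_sum_carrier)
  fix h assume h: "h \<in> carrier G"
  note \<rho>c = rep_carrier[OF r]
  have F: "a g \<cdot>\<^sub>m \<rho> g \<in> carrier_mat n n" if "g \<in> carrier G" for g using \<rho>c[OF that] by simp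
  have eq: "a (h \<otimes> g \<otimes> inv h) \<cdot>\<^sub>m \<rho> (h \<otimes> g \<otimes> inv h) * \<rho> h = \<rho> h * (a g \<cdot>\<^sub>m \<rho> g)" if g: "g \<in> carrier G" for g
  proof -
    have "\<rho> (h \<otimes> g \<otimes> inv h) * \<rho> h = \<rho> h * \<rho> g"
      using h g by (simp add: rep_mult[OF r, symmetric] m_assoc)
    moreover have "a (h \<otimes> g \<otimes> inv h) = a g" using a h g by (simp add: class_function_def)
    ultimately show ?thesis
      using mult_smult_distrib[OF \<rho>c[OF h] \<rho>c[OF g], of "a g"]
        mult_smult_assoc_mat[OF \<rho>c \<rho>c[OF h], of "h \<otimes> g \<otimes> inv h" "a g"] h g by simp
  qed
  have "group_sum n a \<rho> * \<rho> h = msum n n (carrier G) (\<lambda>g. a g \<cdot>\<^sub>m \<rho> g * \<rho> h)"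
    unfolding group_sum_def by (rule msum_mult[OF \<rho>c[OF h] F])
  also have "\<dots> = msum n n (carrier G) (\<lambda>g. a (h \<otimes> g \<otimes> inv h) \<cdot>\<^sub>m \<rho> (h \<otimes> g \<otimes> inv h) * \<rho> h)"
    by (rule msum_reindex[OF bij_betw_conj[OF h]])
  also have "\<dots> = msum n n (carrier G) (\<lambda>g. \<rho> h * (a g \<cdot>\<^sub>m \<rho> g))"
    by (rule msum_cong) (rule eq)
  also have "\<dots> = \<rho> h * group_sum n a \<rho>"
    unfolding group_sum_def by (rule mult_msum[OF \<rho>c[OF h] F, symmetric])
  finally show "\<rho> h * group_sum n a \<rho> = group_sum n a \<rho> * \<rho> h" by simp
qed

lemma group_sum_irreducible_zero:
  assumes ir: "irreducible_representation G n \<rho>" and f: "class_function G f"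
    and orth: "cf_inner G f (afforded_character G \<rho>) = 0"
  shows "group_sum n (\<lambda>g. cnj (f g)) \<rho> = 0\<^sub>m n n"
proof -
  have r: "representation G n \<rho>" and n: "n > 0" using ir by (auto simp: irreducible_representation_def)
  have "class_function G (\<lambda>g. cnj (f g))" using f by (simp add: class_function_def)
  from schur_scalar[OF ir group_sum_intertwines[OF r this]]
  obtain c where c: "group_sum n (\<lambda>g. cnj (f g)) \<rho> = c \<cdot>\<^sub>m 1\<^sub>m n" by blast
  have "c * of_nat n = mat_trace (group_sum n (\<lambda>g. cnj (f g)) \<rho>)"
    unfolding c by (simp add: mat_trace_smult[OF one_carrier_mat] mat_trace_one)
  also have "\<dots> = (\<Sum>g\<in>carrier G. mat_trace (cnj (f g) \<cdot>\<^sub>m \<rho> g))"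
    unfolding group_sum_def by (rule mat_trace_msum) (use rep_carrier[OF r] in simp)
  also have "\<dots> = (\<Sum>g\<in>carrier G. cnj (f g) * mat_trace (\<rho> g))"
    by (intro sum.cong refl mat_trace_smult[OF rep_carrier[OF r]])
  also have "\<dots> = cnj (\<Sum>g\<in>carrier G. f g * cnj (afforded_character G \<rho> g))"
    by (simp add: afforded_character_def)
  also have "(\<Sum>g\<in>carrier G. f g * cnj (afforded_character G \<rho> g)) = 0"
    using orth order_pos by (simp add: cf_inner_def Coset.order_def)
  finally have "c = 0" using n by simp
  then show ?thesis unfolding c by (intro eq_matI) auto
qed

text \<open>The left regular representation by permutation matrices, with respect to an enumeration \<open>e\<close> of the
  group elements by the natural numbers below the group order.\<close>

definition regular_rep :: "(nat \<Rightarrow> 'a) \<Rightarrow> 'a \<Rightarrow> complex mat" where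
  "regular_rep e g = mat (card (carrier G)) (card (carrier G)) (\<lambda>(i, j). if e i = g \<otimes> e j then 1 else 0)"

lemma regular_rep_carrier: "regular_rep e g \<in> carrier_mat (card (carrier G)) (card (carrier G))"
  by (simp add: regular_rep_def)

lemma representation_regular_rep:
  assumes e: "bij_betw e {..<card (carrier G)} (carrier G)"
  shows "representation G (card (carrier G)) (regular_rep e)"
proof (rule representationI[OF regular_rep_carrier])
  let ?N = "card (carrier G)"
  have ec: "e i \<in> carrier G" if "i < ?N" for i using e that by (auto simp: bij_betw_def)
  have inj: "e i = e j \<longleftrightarrow> i = j" if "i < ?N" "j < ?N" for i j
    using e that by (auto simp: bij_betw_def inj_on_def)
  show "regular_rep e \<one> = 1\<^sub>m ?N"
    by (rule eq_matI) (auto simp: regular_rep_def inj ec)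
  fix g h assume g: "g \<in> carrier G" and h: "h \<in> carrier G"
  show "regular_rep e (g \<otimes> h) = regular_rep e g * regular_rep e h"
  proof (rule eq_matI)
    fix i j assume "i < dim_row (regular_rep e g * regular_rep e h)" "j < dim_col (regular_rep e g * regular_rep e h)"
    then have ij: "i < ?N" "j < ?N" by (auto simp: regular_rep_def)
    obtain k where k: "k < ?N" "e k = h \<otimes> e j"
      using e ec[OF ij(2)] h by (metis bij_betw_iff_bijections lessThan_iff m_closed)
    have "(regular_rep e g * regular_rep e h) $$ (i, j) =
        (\<Sum>l<?N. if l = k then (if e i = g \<otimes> e k then 1 else 0) else 0)"
      unfolding mult_mat_entry[OF regular_rep_carrier regular_rep_carrier ij]
      using ij k by (intro sum.cong refl) (auto simp: regular_rep_def inj simp flip: k(2))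
    then show "regular_rep e (g \<otimes> h) $$ (i, j) = (regular_rep e g * regular_rep e h) $$ (i, j)"
      using ij k g h ec[OF ij(2)] by (simp add: regular_rep_def m_assoc del: index_mult_mat)
  qed (auto simp: regular_rep_def)
qed

text \<open>The regular representation is unitary, so the adjoint of the action of \<open>a\<close> is again the action of a
  group algebra element.\<close>

lemma group_sum_adjoint_regular:
  "mat_adjoint (group_sum (card (carrier G)) a (regular_rep e)) =
    group_sum (card (carrier G)) (\<lambda>g. cnj (a (inv g))) (regular_rep e)"
    if e: "bij_betw e {..<card (carrier G)} (carrier G)"
proof (rule eq_matI)
  let ?N = "card (carrier G)"
  have ec: "e i \<in> carrier G" if "i < ?N" for i using e that by (auto simp: bij_betw_def)
  fix i j assume "i < dim_row (group_sum ?N (\<lambda>g. cnj (a (inv g))) (regular_rep e))"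
    "j < dim_col (group_sum ?N (\<lambda>g. cnj (a (inv g))) (regular_rep e))"
  then have ij: "i < ?N" "j < ?N" by (auto simp: group_sum_def)
  have "e j = inv g \<otimes> e i \<longleftrightarrow> e i = g \<otimes> e j" if "g \<in> carrier G" for g
    using that ec[OF ij(1)] ec[OF ij(2)] by (metis inv_solve_left)
  then have "(\<Sum>g\<in>carrier G. cnj (a (inv g)) * (if e j = inv g \<otimes> e i then 1 else 0)) =
      (\<Sum>g\<in>carrier G. cnj (a (inv g)) * (if e i = g \<otimes> e j then 1 else 0))"
    by (intro sum.cong) auto
  moreover have "(\<Sum>g\<in>carrier G. cnj (a g) * (if e j = g \<otimes> e i then 1 else 0)) =
      (\<Sum>g\<in>carrier G. cnj (a (inv g)) * (if e j = inv g \<otimes> e i then 1 else 0))"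
    by (rule sum.reindex_bij_betw[OF bij_betw_inv, symmetric])
  moreover have "mat_adjoint (group_sum ?N a (regular_rep e)) $$ (i, j) =
      (\<Sum>g\<in>carrier G. cnj (a g) * (if e j = g \<otimes> e i then 1 else 0))"
    unfolding index_mat_adjoint[OF group_sum_carrier ij] using ij
    by (simp add: group_sum_def regular_rep_def if_distrib cong: if_cong)
  ultimately show "mat_adjoint (group_sum ?N a (regular_rep e)) $$ (i, j) =
      group_sum ?N (\<lambda>g. cnj (a (inv g))) (regular_rep e) $$ (i, j)"
    using ij by (simp add: group_sum_def regular_rep_def)
qed (use carrier_matD[OF mat_adjoint_carrier[OF group_sum_carrier]] carrier_matD[OF group_sum_carrier] in simp_all)

lemma class_function_orthogonal_imp_zero:
  assumes f: "class_function G f" and orth: "\<And>\<chi>. \<chi> \<in> Irr G \<Longrightarrow> cf_inner G f \<chi> = 0"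
    and x: "x \<in> carrier G"
  shows "f x = 0"
proof -
  let ?N = "card (carrier G)"
  obtain e where e: "bij_betw e {..<?N} (carrier G)"
    using ex_bij_betw_nat_finite[OF fin] by (auto simp: atLeast0LessThan)
  let ?R = "regular_rep e"
  define A where "A = group_sum ?N (\<lambda>g. cnj (f g)) ?R"
  define B where "B = group_sum ?N (\<lambda>g. f (inv g)) ?R"
  have Ac: "A \<in> carrier_mat ?N ?N" and Bc: "B \<in> carrier_mat ?N ?N"
    by (auto simp: A_def B_def group_sum_carrier)
  have BA: "B = mat_adjoint A"
    unfolding A_def B_def group_sum_adjoint_regular[OF e] by simp
  note R = representation_regular_rep[OF e]
  have "class_function G (\<lambda>g. f (inv g))"
    unfolding class_function_def
  proof (intro ballI)
    fix g y assume g: "g \<in> carrier G" and y: "y \<in> carrier G"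
    have "inv (y \<otimes> g \<otimes> inv y) = y \<otimes> inv g \<otimes> inv y"
      using g y by (simp add: inv_mult_group m_assoc)
    then show "f (inv (y \<otimes> g \<otimes> inv y)) = f (inv g)"
      using f g y by (simp add: class_function_def)
  qed
  then have B: "intertwines ?N ?N ?R ?R B" unfolding B_def by (rule group_sum_intertwines[OF R])
  define W where "W = (\<lambda>v. B *\<^sub>v v) ` carrier_vec ?N"
  have W: "invariant_subspace G ?N ?R W" unfolding W_def by (rule range_invariant[OF R R B])
  \<comment> \<open>The range of \<open>A\<^sup>*\<close> meets the kernel of \<open>A\<close> trivially.\<close>
  have AW: "w = 0\<^sub>v ?N" if w: "w \<in> W" "A *\<^sub>v w = 0\<^sub>v ?N" for w
  proof -
    obtain v where v: "v \<in> carrier_vec ?N" "w = B *\<^sub>v v" using w by (auto simp: W_def)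
    have wc: "w \<in> carrier_vec ?N" using v Bc by simp
    have "w \<bullet>c w = v \<bullet>c (A *\<^sub>v w)"
      using cscalar_prod_adjoint[OF Ac v(1) wc] v(2) BA by simp
    also have "\<dots> = 0" using w(2) v(1) by simp
    finally show ?thesis using wc by simp
  qed
  have "W = {0\<^sub>v ?N}"
  proof (rule ccontr)
    assume "W \<noteq> {0\<^sub>v ?N}"
    then obtain k \<sigma> Q L where \<sigma>: "irreducible_representation G k \<sigma>" and Q: "Q \<in> carrier_mat ?N k"
      and L: "L \<in> carrier_mat k ?N" and LQ: "L * Q = 1\<^sub>m k"
      and inter: "\<forall>g\<in>carrier G. ?R g * Q = Q * \<sigma> g" and QW: "\<forall>v\<in>carrier_vec k. Q *\<^sub>v v \<in> W"
      by (rule exists_irreducible_subrepresentation[OF R W])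
    have s: "representation G k \<sigma>" and k: "k > 0" using \<sigma> by (auto simp: irreducible_representation_def)
    have "afforded_character G \<sigma> \<in> Irr G" using \<sigma> by (auto simp: Irr_def)
    then have gs0: "group_sum k (\<lambda>g. cnj (f g)) \<sigma> = 0\<^sub>m k k"
      by (intro group_sum_irreducible_zero[OF \<sigma> f] orth)
    have Rc: "cnj (f g) \<cdot>\<^sub>m ?R g \<in> carrier_mat ?N ?N" for g using regular_rep_carrier by simp
    have \<sigma>c: "cnj (f g) \<cdot>\<^sub>m \<sigma> g \<in> carrier_mat k k" if "g \<in> carrier G" for g using rep_carrier[OF s that] by simp
    have eq: "cnj (f g) \<cdot>\<^sub>m ?R g * Q = Q * (cnj (f g) \<cdot>\<^sub>m \<sigma> g)" if g: "g \<in> carrier G" for g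
      using mult_smult_assoc_mat[OF regular_rep_carrier Q, of "cnj (f g)" e g] inter g
        mult_smult_distrib[OF Q rep_carrier[OF s g], of "cnj (f g)"] by simp
    have "A * Q = msum ?N k (carrier G) (\<lambda>g. cnj (f g) \<cdot>\<^sub>m ?R g * Q)"
      unfolding A_def group_sum_def by (rule msum_mult[OF Q Rc])
    also have "\<dots> = msum ?N k (carrier G) (\<lambda>g. Q * (cnj (f g) \<cdot>\<^sub>m \<sigma> g))"
      by (rule msum_cong) (rule eq)
    also have "\<dots> = Q * group_sum k (\<lambda>g. cnj (f g)) \<sigma>"
      unfolding group_sum_def by (rule mult_msum[OF Q \<sigma>c, symmetric])
    also have "\<dots> = 0\<^sub>m ?N k" unfolding gs0 using Q by simp
    finally have AQ: "A * Q = 0\<^sub>m ?N k" .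
    let ?u = "unit_vec k 0 :: complex vec"
    have u: "?u \<in> carrier_vec k" by simp
    have "A *\<^sub>v (Q *\<^sub>v ?u) = 0\<^sub>m ?N k *\<^sub>v ?u" using assoc_mult_mat_vec[OF Ac Q u] AQ by simp
    also have "\<dots> = 0\<^sub>v ?N" by (intro eq_vecI) (auto simp: scalar_prod_def)
    finally have "Q *\<^sub>v ?u = 0\<^sub>v ?N" using AW QW u by blast
    then have "?u = L *\<^sub>v 0\<^sub>v ?N" using assoc_mult_mat_vec[OF L Q u] LQ u by simp
    also have "\<dots> = 0\<^sub>v k" by (rule mult_mat_vec_zero[OF L])
    finally have "?u $ 0 = 0\<^sub>v k $ 0" by simp
    then show False using k by simp
  qed
  have B0: "B = 0\<^sub>m ?N ?N"
  proof (rule eq_mat_by_vecI[OF Bc])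
    fix v :: "complex vec" assume v: "v \<in> carrier_vec ?N"
    have "B *\<^sub>v v \<in> W" using v by (simp add: W_def)
    then have "B *\<^sub>v v = 0\<^sub>v ?N" using \<open>W = {0\<^sub>v ?N}\<close> by simp
    also have "\<dots> = 0\<^sub>m ?N ?N *\<^sub>v v" using v by (intro eq_vecI) (auto simp: scalar_prod_def)
    finally show "B *\<^sub>v v = 0\<^sub>m ?N ?N *\<^sub>v v" .
  qed simp
  have surj: "\<exists>i<?N. e i = y" if "y \<in> carrier G" for y
  proof -
    have "y \<in> e ` {..<?N}" using bij_betw_imp_surj_on[OF e] that by simp
    then show ?thesis by auto
  qed
  obtain i where i: "i < ?N" "e i = inv x" using surj[OF inv_closed[OF x]] by blast
  obtain j where j: "j < ?N" "e j = \<one>" using surj[OF one_closed] by blast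
  have "B $$ (i, j) = (\<Sum>g\<in>carrier G. f (inv g) * (if e i = g \<otimes> e j then 1 else 0))"
    using i(1) j(1) by (simp add: B_def group_sum_def regular_rep_def)
  also have "\<dots> = (\<Sum>g\<in>carrier G. if g = inv x then f x else 0)"
    unfolding i(2) j(2) using x by (intro sum.cong refl) auto
  also have "\<dots> = f x" using x fin by simp
  finally show ?thesis using B0 i(1) j(1) by simp
qed

lemma class_function_expansion:
  assumes f: "class_function G f" and x: "x \<in> carrier G"
  shows "f x = (\<Sum>\<chi>\<in>Irr G. cf_inner G f \<chi> * \<chi> x)"
proof -
  define d where "d g = f g - (\<Sum>\<chi>\<in>Irr G. cf_inner G f \<chi> * \<chi> g)" for g
  have "class_function G d"
    using f Irr_class_function unfolding class_function_def d_def by (auto intro!: arg_cong2[of _ _ _ _ minus] sum.cong)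
  moreover have "cf_inner G d \<chi> = 0" if "\<chi> \<in> Irr G" for \<chi>
    unfolding d_def by (rule cf_inner_projection[OF finite_Irr subset_refl that])
  ultimately have "d x = 0" using x by (rule class_function_orthogonal_imp_zero)
  then show ?thesis by (simp add: d_def)
qed

section \<open>Counting commutators\<close>

lemma class_function_commutator_count:
  assumes H: "H \<lhd> G"
  shows "class_function G (\<lambda>g. of_nat (commutator_count G H g))"
  unfolding class_function_def
proof (intro ballI)
  fix g x assume g: "g \<in> carrier G" and x: "x \<in> carrier G"
  interpret H: normal H G by (rule H)
  have conj_mult: "(y \<otimes> a \<otimes> inv y) \<otimes> (y \<otimes> b \<otimes> inv y) = y \<otimes> (a \<otimes> b) \<otimes> inv y"
    if "y \<in> carrier G" "a \<in> carrier G" "b \<in> carrier G" for y a b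
    using that by (simp add: m_assoc) (simp add: m_assoc[symmetric])
  have conj_inv: "inv (y \<otimes> a \<otimes> inv y) = y \<otimes> inv a \<otimes> inv y"
    if "y \<in> carrier G" "a \<in> carrier G" for y a
    using that by (simp add: inv_mult_group m_assoc)
  have comm: "commutator G (y \<otimes> a \<otimes> inv y) (y \<otimes> b \<otimes> inv y) = y \<otimes> commutator G a b \<otimes> inv y"
    if "y \<in> carrier G" "a \<in> carrier G" "b \<in> carrier G" for y a b
    using that by (simp add: commutator_def conj_mult conj_inv)
  have Hconj: "y \<otimes> h \<otimes> inv y \<in> H" if "y \<in> carrier G" "h \<in> H" for y h
    using H.inv_op_closed2 that by blast
  have cancel: "inv y \<otimes> (y \<otimes> a \<otimes> inv y) \<otimes> y = a" "y \<otimes> (inv y \<otimes> a \<otimes> y) \<otimes> inv y = a"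
    if "y \<in> carrier G" "a \<in> carrier G" for y a
    using that by (simp_all add: m_assoc) (simp_all add: m_assoc[symmetric])
  let ?S = "\<lambda>g. {(h, z). h \<in> H \<and> z \<in> carrier G \<and> commutator G h z = g}"
  let ?c = "\<lambda>y (h, z). (y \<otimes> h \<otimes> inv y, y \<otimes> z \<otimes> inv y)"
  have maps: "?c y p \<in> ?S (y \<otimes> a \<otimes> inv y)" if "y \<in> carrier G" "p \<in> ?S a" for y a p
    using that Hconj comm by auto
  have "bij_betw (?c x) (?S g) (?S (x \<otimes> g \<otimes> inv x))"
  proof (rule bij_betw_byWitness[where f' = "?c (inv x)"])
    show "\<forall>p\<in>?S g. ?c (inv x) (?c x p) = p" using x cancel by auto
    show "\<forall>p\<in>?S (x \<otimes> g \<otimes> inv x). ?c x (?c (inv x) p) = p" using x cancel by auto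
    show "?c x ` ?S g \<subseteq> ?S (x \<otimes> g \<otimes> inv x)"
      by (rule image_subsetI) (rule maps[OF x])
    have eq: "inv x \<otimes> (x \<otimes> g \<otimes> inv x) \<otimes> inv (inv x) = g" using cancel(1)[OF x g] x by simp
    show "?c (inv x) ` ?S (x \<otimes> g \<otimes> inv x) \<subseteq> ?S g"
      by (rule image_subsetI) (rule maps[OF inv_closed[OF x], of _ "x \<otimes> g \<otimes> inv x", unfolded eq])
  qed
  then have "commutator_count G H (x \<otimes> g \<otimes> inv x) = commutator_count G H g"
    unfolding commutator_count_def by (rule bij_betw_same_card[symmetric])
  then show "complex_of_nat (commutator_count G H (x \<otimes> g \<otimes> inv x)) = of_nat (commutator_count G H g)"
    by simp
qed

text \<open>Since \<open>[h, x] = h (x h\<^sup>-\<^sup>1 x\<^sup>-\<^sup>1)\<close>, this is the trace of \<open>\<rho> h\<close> times the average of conjugates of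
  \<open>\<rho> h\<^sup>-\<^sup>1\<close>, which is scalar by \<open>schur_average_scalar\<close>.\<close>

lemma sum_Irr_commutator:
  assumes \<chi>: "\<chi> \<in> Irr G" and h: "h \<in> carrier G"
  shows "(\<Sum>x\<in>carrier G. \<chi> (commutator G h x)) = of_nat (card (carrier G)) * (\<chi> h * cnj (\<chi> h)) / \<chi> \<one>"
proof -
  from \<chi> obtain n \<rho> where r: "irreducible_representation G n \<rho>" "representation G n \<rho>" and n: "\<chi> \<one> = of_nat n"
    and c: "\<And>g. g \<in> carrier G \<Longrightarrow> \<chi> g = mat_trace (\<rho> g)" by (rule Irr_cases) blast
  note \<rho>c = rep_carrier[OF r(2)]
  have hi: "inv h \<in> carrier G" using h by simp
  let ?F = "\<lambda>x. \<rho> x * \<rho> (inv h) * \<rho> (inv x)"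
  have F: "?F x \<in> carrier_mat n n" if "x \<in> carrier G" for x
    using \<rho>c[OF that] \<rho>c[OF hi] \<rho>c[OF inv_closed[OF that]] by simp
  have "\<chi> (commutator G h x) = mat_trace (\<rho> h * ?F x)" if x: "x \<in> carrier G" for x
  proof -
    have "commutator G h x = h \<otimes> (x \<otimes> inv h \<otimes> inv x)"
      using h x by (simp add: commutator_def m_assoc)
    then show ?thesis using h x c by (simp add: rep_mult[OF r(2)])
  qed
  then have "(\<Sum>x\<in>carrier G. \<chi> (commutator G h x)) = (\<Sum>x\<in>carrier G. mat_trace (\<rho> h * ?F x))" by simp
  also have "\<dots> = mat_trace (msum n n (carrier G) (\<lambda>x. \<rho> h * ?F x))"
    by (rule mat_trace_msum[symmetric]) (use F \<rho>c[OF h] in simp)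
  also have "msum n n (carrier G) (\<lambda>x. \<rho> h * ?F x) = \<rho> h * msum n n (carrier G) ?F"
    by (rule mult_msum[OF \<rho>c[OF h] F, symmetric])
  also have "\<dots> = (of_nat (card (carrier G)) * mat_trace (\<rho> (inv h)) / of_nat n) \<cdot>\<^sub>m \<rho> h"
    unfolding schur_average_scalar[OF r(1) \<rho>c[OF hi]]
    using mult_smult_distrib[OF \<rho>c[OF h] one_carrier_mat] \<rho>c[OF h] by simp
  also have "mat_trace \<dots> = (of_nat (card (carrier G)) * mat_trace (\<rho> (inv h)) / of_nat n) * mat_trace (\<rho> h)"
    by (rule mat_trace_smult[OF \<rho>c[OF h]])
  finally show ?thesis using c[OF h] mat_trace_inv[OF r(2) h] n by simp
qed

lemma cf_inner_commutator_count:
  assumes H: "subgroup H G" and \<chi>: "\<chi> \<in> Irr G"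
  shows "cf_inner G (\<lambda>g. of_nat (commutator_count G H g)) \<chi> = (\<Sum>h\<in>H. \<chi> h * cnj (\<chi> h)) / \<chi> \<one>"
proof -
  have HG: "H \<subseteq> carrier G" using H by (rule subgroup.subset)
  then have finH: "finite H" using fin finite_subset by blast
  have cc: "commutator G h x \<in> carrier G" if "h \<in> H" "x \<in> carrier G" for h x
    using that HG by (auto simp: commutator_def)
  have count: "of_nat (commutator_count G H g) = (\<Sum>p\<in>H \<times> carrier G. if commutator G (fst p) (snd p) = g then 1 else (0::complex))" for g
  proof -
    have "{(h, x). h \<in> H \<and> x \<in> carrier G \<and> commutator G h x = g} = {p \<in> H \<times> carrier G. commutator G (fst p) (snd p) = g}"
      by auto
    then show ?thesis unfolding commutator_count_def using finH fin by (simp add: sum.If_cases Int_def)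
  qed
  have "(\<Sum>g\<in>carrier G. of_nat (commutator_count G H g) * cnj (\<chi> g)) =
      (\<Sum>g\<in>carrier G. \<Sum>p\<in>H \<times> carrier G. if commutator G (fst p) (snd p) = g then cnj (\<chi> g) else 0)"
    unfolding count sum_distrib_right by (intro sum.cong refl) simp
  also have "\<dots> = (\<Sum>p\<in>H \<times> carrier G. \<Sum>g\<in>carrier G. if commutator G (fst p) (snd p) = g then cnj (\<chi> g) else 0)"
    by (rule sum.swap)
  also have "\<dots> = (\<Sum>p\<in>H \<times> carrier G. cnj (\<chi> (commutator G (fst p) (snd p))))"
    using cc fin by (intro sum.cong refl) auto
  also have "\<dots> = (\<Sum>h\<in>H. \<Sum>x\<in>carrier G. cnj (\<chi> (commutator G h x)))"
    by (simp add: sum.cartesian_product case_prod_unfold)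
  also have "\<dots> = (\<Sum>h\<in>H. cnj (of_nat (card (carrier G)) * (\<chi> h * cnj (\<chi> h)) / \<chi> \<one>))"
  proof (intro sum.cong refl)
    fix h assume "h \<in> H"
    then have "h \<in> carrier G" using HG by blast
    from sum_Irr_commutator[OF \<chi> this]
    show "(\<Sum>x\<in>carrier G. cnj (\<chi> (commutator G h x))) =
        cnj (of_nat (card (carrier G)) * (\<chi> h * cnj (\<chi> h)) / \<chi> \<one>)"
      by (metis cnj_sum)
  qed
  also have "\<dots> = (\<Sum>h\<in>H. of_nat (card (carrier G)) * (\<chi> h * cnj (\<chi> h)) / \<chi> \<one>)"
  proof -
    from \<chi> obtain n where "\<chi> \<one> = of_nat n" by (rule Irr_cases) blast
    then show ?thesis by (simp add: mult.commute)
  qed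
  also have "\<dots> = of_nat (card (carrier G)) * ((\<Sum>h\<in>H. \<chi> h * cnj (\<chi> h)) / \<chi> \<one>)"
    by (simp add: sum_distrib_left sum_divide_distrib)
  finally show ?thesis using order_pos by (simp add: cf_inner_def Coset.order_def)
qed

lemma frobenius_reciprocity:
  assumes H: "subgroup H G" and \<psi>: "class_function G \<psi>"
  shows "cf_inner G (induced_cf G H \<phi>) \<psi> = cf_inner (G\<lparr>carrier := H\<rparr>) \<phi> \<psi>"
proof -
  let ?N = "of_nat (card (carrier G)) :: complex"
  have HG: "H \<subseteq> carrier G" using H by (rule subgroup.subset)
  let ?t = "\<lambda>y. if y \<in> H then \<phi> y * cnj (\<psi> y) else 0"
  have conj: "(\<Sum>g\<in>carrier G. ?t (x \<otimes> g \<otimes> inv x)) = (\<Sum>h\<in>H. \<phi> h * cnj (\<psi> h))" if x: "x \<in> carrier G" for x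
  proof -
    have "(\<Sum>g\<in>carrier G. ?t (x \<otimes> g \<otimes> inv x)) = (\<Sum>y\<in>carrier G. ?t y)"
      by (rule sum.reindex_bij_betw[OF bij_betw_conj[OF x]])
    also have "\<dots> = (\<Sum>h\<in>H. \<phi> h * cnj (\<psi> h))"
      using HG fin by (simp add: sum.If_cases Int_absorb1)
    finally show ?thesis .
  qed
  have "(\<Sum>g\<in>carrier G. induced_cf G H \<phi> g * cnj (\<psi> g)) =
      (\<Sum>g\<in>carrier G. (\<Sum>x\<in>carrier G. ?t (x \<otimes> g \<otimes> inv x)) / of_nat (card H))"
  proof (intro sum.cong refl)
    fix g assume g: "g \<in> carrier G"
    have "(\<Sum>x\<in>carrier G. let y = x \<otimes> g \<otimes> inv x in if y \<in> H then \<phi> y else 0) * cnj (\<psi> g) =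
        (\<Sum>x\<in>carrier G. ?t (x \<otimes> g \<otimes> inv x))"
      unfolding sum_distrib_right using \<psi> g by (intro sum.cong refl) (simp add: class_function_def Let_def)
    then show "induced_cf G H \<phi> g * cnj (\<psi> g) = (\<Sum>x\<in>carrier G. ?t (x \<otimes> g \<otimes> inv x)) / of_nat (card H)"
      using g by (simp add: induced_cf_def)
  qed
  also have "\<dots> = (\<Sum>g\<in>carrier G. \<Sum>x\<in>carrier G. ?t (x \<otimes> g \<otimes> inv x)) / of_nat (card H)"
    by (rule sum_divide_distrib[symmetric])
  also have "(\<Sum>g\<in>carrier G. \<Sum>x\<in>carrier G. ?t (x \<otimes> g \<otimes> inv x)) = ?N * (\<Sum>h\<in>H. \<phi> h * cnj (\<psi> h))"
    by (subst sum.swap) (simp add: conj)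
  finally show ?thesis using order_pos by (simp add: cf_inner_def Coset.order_def)
qed

end

theorem theorem3p3p1:
  fixes G :: "('a, 'b) monoid_scheme" and H :: "'a set"
  assumes "group G" and "finite (carrier G)" and "H \<lhd> G"
  shows "class_function G (\<lambda>g. of_nat (commutator_count G H g)) \<and>
    (\<forall>g\<in>carrier G.
      of_nat (commutator_count G H g) =
        (\<Sum>\<chi>\<in>Irr G. of_nat (card H) *
           cf_inner (G\<lparr>carrier := H\<rparr>) (restrict \<chi> H) (restrict \<chi> H) / \<chi> \<one>\<^bsub>G\<^esub> * \<chi> g) \<and>
      of_nat (commutator_count G H g) =
        (\<Sum>\<chi>\<in>Irr G. of_nat (card H) *
           cf_inner G (induced_cf G H (restrict \<chi> H)) \<chi> / \<chi> \<one>\<^bsub>G\<^esub> * \<chi> g))"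
proof -
  interpret finite_group G using assms by (simp add: finite_group_def finite_group_axioms_def)
  have H: "subgroup H G" using assms(3) by (rule normal_imp_subgroup)
  have "finite H" using subgroup.subset[OF H] fin finite_subset by blast
  moreover have "H \<noteq> {}" using subgroup.one_closed[OF H] by blast
  ultimately have cardH: "card H > 0" by (simp add: card_gt_0_iff)
  let ?z = "\<lambda>g. of_nat (commutator_count G H g) :: complex"
  have cf: "class_function G ?z" by (rule class_function_commutator_count[OF assms(3)])
  have 1: "of_nat (card H) * cf_inner (G\<lparr>carrier := H\<rparr>) (restrict \<chi> H) (restrict \<chi> H) / \<chi> \<one>\<^bsub>G\<^esub>
      = cf_inner G ?z \<chi>" if \<chi>: "\<chi> \<in> Irr G" for \<chi>
    using cf_inner_commutator_count[OF H \<chi>] cardH by (simp add: cf_inner_def Coset.order_def)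
  have 2: "cf_inner G (induced_cf G H (restrict \<chi> H)) \<chi> =
      cf_inner (G\<lparr>carrier := H\<rparr>) (restrict \<chi> H) (restrict \<chi> H)" if \<chi>: "\<chi> \<in> Irr G" for \<chi>
    unfolding frobenius_reciprocity[OF H Irr_class_function[OF \<chi>]] by (simp add: cf_inner_def)
  show ?thesis
    using cf class_function_expansion[OF cf] by (simp add: 1 2)
qed

end
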